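(* Let $\mathrm L$ be a semilinear core expansion of $\mathrm{MTL}$ that is not an $\mathrm{SMTL}$ logic. The logic $\mathrm L^{\min}_\circ$ is complete with respect to the class of $\mathrm L^{\min}_\circ$-chains, i.e. the $\mathrm L_\circ$-chains where the $\circ$ operator is the (pointwise) minimal one, namely $\circ(0)=\circ(1)=1$ and $\circ(x)=0$ for $0<x<1$.
   Context: $\mathrm{MTL}$: formulas are built from countably many propositional variables with binary connectives $\wedge,\&,\to$ and the constant $\overline 0$; $\neg\varphi:=\varphi\to\overline 0$, $\overline 1:=\neg\overline 0$, $\varphi\vee\psi:=((\varphi\to\psi)\to\psi)\wedge((\psi\to\varphi)\to\varphi)$, $\varphi\leftrightarrow\psi:=(\varphi\to\psi)\wedge(\psi\to\varphi)$. Its axiom schemata are $(\varphi\to\psi)\to((\psi\to\chi)\to(\varphi\to\chi))$; $\varphi\&\psi\to\varphi$; $\varphi\&\psi\to\psi\&\varphi$; $\varphi\wedge\psi\to\varphi$; $\varphi\wedge\psi\to\psi\wedge\varphi$; $\varphi\&(\varphi\to\psi)\to\varphi\wedge\psi$; $(\varphi\to(\psi\to\chi))\to(\varphi\&\psi\to\chi)$; $(\varphi\&\psi\to\chi)\to(\varphi\to(\psi\to\chi))$; $((\varphi\to\psi)\to\chi)\to(((\psi\to\varphi)\to\chi)\to\chi)$; $\overline 0\to\varphi$; its only rule is modus ponens. An $\mathrm{MTL}$-algebra is a commutative bounded integral residuated lattice $\langle A,\wedge,\vee,\&,\to,0,1\rangle$ with $(x\to y)\vee(y\to x)=1$. A core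 expansion of $\mathrm{MTL}$ is a finitary logic $\mathrm L$ obtained from $\mathrm{MTL}$ by possibly adding new connectives, axiom schemata and finitary rule schemata, such that for each new $n$-ary connective $c$ and each argument place, $\varphi\to\psi,\psi\to\varphi\vdash_{\mathrm L}c(\ldots,\varphi,\ldots)\to c(\ldots,\psi,\ldots)$. An $\mathrm L$-algebra is an $\mathrm{MTL}$-algebra with operations interpreting the new connectives such that, under every evaluation, all axioms of $\mathrm L$ get value $1$ and all rules of $\mathrm L$ preserve the value $1$. An $\mathrm L$-chain is a linearly ordered $\mathrm L$-algebra. $\mathrm L$ is semilinear if it is strongly complete w.r.t. $\mathrm L$-chains: $\Gamma\vdash_{\mathrm L}\varphi$ iff for every $\mathrm L$-chain and every evaluation $e$ into it, $e(\gamma)=1$ for all $\gamma\in\Gamma$ implies $e(\varphi)=1$. Completeness of a logic w.r.t. a class of chains is understood in this same sense. "$\mathrm L$ is not an $\mathrm{SMTL}$ logic" means that $\mathrm L$ does not prove the schema $\varphi\wedge\neg\varphi\to\overline 0$. The logic $\mathrm L_\circ$ is the expansion of (an axiomatization of) $\mathrm L$ with a new unary connective $\circ$, the axioms $\neg(\varphi\wedge\neg\varphi\wedge\circ\varphi)$, $\circ\overline 1$, $\circ\overline 0$, and the rules (Cong): from $(\varphi\leftrightarrow\psi)\vee\delta$ derive $(\circ\varphi\leftrightarrow\circ\psi)\vee\delta$; (Coh): from $(\neg\neg\varphi\wedge(\varphi\to\psi))\vee\delta$ derive $(\circ\varphi\to\circ\psi)\vee\delta$ (all schemata being in the expanded language).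 An $\mathrm L_\circ$-chain is an $\mathrm L$-chain with a unary operation $\circ$ such that for all $x,y,z$: $x\wedge\neg x\wedge\circ(x)=0$; $\circ(1)=\circ(0)=1$; if $(\neg\neg x\wedge(x\to y))\vee z=1$ then $(\circ(x)\to\circ(y))\vee z=1$. $\mathrm L^{\min}_\circ$ is the axiomatic extension of $\mathrm L_\circ$ with the axiom $\varphi\vee\neg\varphi\vee\neg\circ\varphi$. $\mathrm L^{\min}_\circ$-chains are the $\mathrm L_\circ$-chains satisfying $x\vee\neg x\vee\neg\circ(x)=1$ for all $x$. *)

theory Defs
  imports "HOL-Algebra.Group"
begin

section \<open>Formulas\<close>

text \<open>The type \<open>'c\<close> provides names for the connectives added to MTL; arities, and the set of
  names actually in use (possibly empty), are recorded in the calculus below.\<close>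

datatype 'c fm =
    Var nat
  | Bot  ("\<^bold>\<bottom>")
  | Meet "'c fm" "'c fm"  (infixr "\<^bold>\<and>" 65)
  | Fus "'c fm" "'c fm"  (infixr "\<^bold>&" 65)
  | Imp "'c fm" "'c fm"  (infixr "\<^bold>\<rightarrow>" 55)
  | Con 'c "'c fm list"

abbreviation Neg :: "'c fm \<Rightarrow> 'c fm"  ("\<^bold>\<not> _" [80] 80)
  where "\<^bold>\<not> \<phi> \<equiv> \<phi> \<^bold>\<rightarrow> \<^bold>\<bottom>"

abbreviation Top :: "'c fm"  ("\<^bold>\<top>")
  where "\<^bold>\<top> \<equiv> \<^bold>\<not> \<^bold>\<bottom>"

abbreviation Join :: "'c fm \<Rightarrow> 'c fm \<Rightarrow> 'c fm"  (infixr "\<^bold>\<or>" 60)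
  where "\<phi> \<^bold>\<or> \<psi> \<equiv> ((\<phi> \<^bold>\<rightarrow> \<psi>) \<^bold>\<rightarrow> \<psi>) \<^bold>\<and> ((\<psi> \<^bold>\<rightarrow> \<phi>) \<^bold>\<rightarrow> \<phi>)"

abbreviation Iff :: "'c fm \<Rightarrow> 'c fm \<Rightarrow> 'c fm"  (infix "\<^bold>\<leftrightarrow>" 54)
  where "\<phi> \<^bold>\<leftrightarrow> \<psi> \<equiv> (\<phi> \<^bold>\<rightarrow> \<psi>) \<^bold>\<and> (\<psi> \<^bold>\<rightarrow> \<phi>)"

primrec subst :: "(nat \<Rightarrow> 'c fm) \<Rightarrow> 'c fm \<Rightarrow> 'c fm" where
  "subst \<sigma> (Var n) = \<sigma> n"
| "subst \<sigma> \<^bold>\<bottom> = \<^bold>\<bottom>"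
| "subst \<sigma> (\<phi> \<^bold>\<and> \<psi>) = subst \<sigma> \<phi> \<^bold>\<and> subst \<sigma> \<psi>"
| "subst \<sigma> (\<phi> \<^bold>& \<psi>) = subst \<sigma> \<phi> \<^bold>& subst \<sigma> \<psi>"
| "subst \<sigma> (\<phi> \<^bold>\<rightarrow> \<psi>) = subst \<sigma> \<phi> \<^bold>\<rightarrow> subst \<sigma> \<psi>"
| "subst \<sigma> (Con c \<phi>s) = Con c (map (subst \<sigma>) \<phi>s)"


section \<open>Expansions of MTL and their consequence relations\<close>

text \<open>A calculus lists only what is added to MTL. An axiom schema is given by a formula and a rule
  schema by a set of premises and a conclusion; the propositional variables play the role of the
  metavariables, that is, all substitution instances may be used in derivations.\<close>

record 'c calculus =
  conns :: "'c set"
  arity :: "'c \<Rightarrow> nat"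
  axs :: "'c fm set"
  rules :: "('c fm set \<times> 'c fm) set"

primrec is_fm :: "'c calculus \<Rightarrow> 'c fm \<Rightarrow> bool" where
  "is_fm L (Var n) \<longleftrightarrow> True"
| "is_fm L \<^bold>\<bottom> \<longleftrightarrow> True"
| "is_fm L (\<phi> \<^bold>\<and> \<psi>) \<longleftrightarrow> is_fm L \<phi> \<and> is_fm L \<psi>"
| "is_fm L (\<phi> \<^bold>& \<psi>) \<longleftrightarrow> is_fm L \<phi> \<and> is_fm L \<psi>"
| "is_fm L (\<phi> \<^bold>\<rightarrow> \<psi>) \<longleftrightarrow> is_fm L \<phi> \<and> is_fm L \<psi>"
| "is_fm L (Con c \<phi>s) \<longleftrightarrow> c \<in> conns L \<and> length \<phi>s = arity L c \<and> list_all (is_fm L) \<phi>s"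

definition fms :: "'c calculus \<Rightarrow> 'c fm set"
  where "fms L = {\<phi>. is_fm L \<phi>}"

definition mtl_axs :: "'c fm set" where
  "mtl_axs = (let \<phi> = Var 0; \<psi> = Var 1; \<chi> = Var 2 in
    {(\<phi> \<^bold>\<rightarrow> \<psi>) \<^bold>\<rightarrow> ((\<psi> \<^bold>\<rightarrow> \<chi>) \<^bold>\<rightarrow> (\<phi> \<^bold>\<rightarrow> \<chi>)),
     \<phi> \<^bold>& \<psi> \<^bold>\<rightarrow> \<phi>,
     \<phi> \<^bold>& \<psi> \<^bold>\<rightarrow> \<psi> \<^bold>& \<phi>,
     \<phi> \<^bold>\<and> \<psi> \<^bold>\<rightarrow> \<phi>,
     \<phi> \<^bold>\<and> \<psi> \<^bold>\<rightarrow> \<psi> \<^bold>\<and> \<phi>,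
     \<phi> \<^bold>& (\<phi> \<^bold>\<rightarrow> \<psi>) \<^bold>\<rightarrow> \<phi> \<^bold>\<and> \<psi>,
     (\<phi> \<^bold>\<rightarrow> (\<psi> \<^bold>\<rightarrow> \<chi>)) \<^bold>\<rightarrow> (\<phi> \<^bold>& \<psi> \<^bold>\<rightarrow> \<chi>),
     (\<phi> \<^bold>& \<psi> \<^bold>\<rightarrow> \<chi>) \<^bold>\<rightarrow> (\<phi> \<^bold>\<rightarrow> (\<psi> \<^bold>\<rightarrow> \<chi>)),
     ((\<phi> \<^bold>\<rightarrow> \<psi>) \<^bold>\<rightarrow> \<chi>) \<^bold>\<rightarrow> (((\<psi> \<^bold>\<rightarrow> \<phi>) \<^bold>\<rightarrow> \<chi>) \<^bold>\<rightarrow> \<chi>),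
     \<^bold>\<bottom> \<^bold>\<rightarrow> \<phi>})"

inductive derives :: "'c calculus \<Rightarrow> 'c fm set \<Rightarrow> 'c fm \<Rightarrow> bool" for L \<Gamma> where
  hyp: "\<phi> \<in> \<Gamma> \<Longrightarrow> derives L \<Gamma> \<phi>"
| ax: "\<lbrakk>\<phi> \<in> mtl_axs \<union> axs L; range \<sigma> \<subseteq> fms L\<rbrakk> \<Longrightarrow> derives L \<Gamma> (subst \<sigma> \<phi>)"
| mp: "\<lbrakk>derives L \<Gamma> \<phi>; derives L \<Gamma> (\<phi> \<^bold>\<rightarrow> \<psi>)\<rbrakk> \<Longrightarrow> derives L \<Gamma> \<psi>"
| rl: "\<lbrakk>(P, \<phi>) \<in> rules L; range \<sigma> \<subseteq> fms L; \<forall>\<psi>\<in>P. derives L \<Gamma> (subst \<sigma> \<psi>)\<rbrakk>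
    \<Longrightarrow> derives L \<Gamma> (subst \<sigma> \<phi>)"

definition core_expansion :: "'c calculus \<Rightarrow> bool" where
  "core_expansion L \<longleftrightarrow>
     axs L \<subseteq> fms L \<and>
     (\<forall>(P, \<phi>)\<in>rules L. finite P \<and> P \<subseteq> fms L \<and> \<phi> \<in> fms L) \<and>
     (\<forall>c\<in>conns L. \<forall>\<chi>s i \<phi> \<psi>.
        length \<chi>s = arity L c \<and> set \<chi>s \<subseteq> fms L \<and> i < arity L c \<and> \<phi> \<in> fms L \<and> \<psi> \<in> fms L \<longrightarrow>
        derives L {\<phi> \<^bold>\<rightarrow> \<psi>, \<psi> \<^bold>\<rightarrow> \<phi>} (Con c (\<chi>s[i := \<phi>]) \<^bold>\<rightarrow> Con c (\<chi>s[i := \<psi>])))"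

definition SMTL_logic :: "'c calculus \<Rightarrow> bool"
  where "SMTL_logic L \<longleftrightarrow> (\<forall>\<phi>\<in>fms L. derives L {} (\<phi> \<^bold>\<and> \<^bold>\<not> \<phi> \<^bold>\<rightarrow> \<^bold>\<bottom>))"


section \<open>Algebras and chains\<close>

text \<open>The operation \<open>&\<close> and the constant \<open>1\<close> are the multiplication and unit of the underlying
  monoid record.\<close>

record ('a, 'c) alg = "'a monoid" +
  wedge :: "['a, 'a] \<Rightarrow> 'a"  (infixl "\<curlywedge>\<index>" 70)
  vee :: "['a, 'a] \<Rightarrow> 'a"  (infixl "\<curlyvee>\<index>" 65)
  resid :: "['a, 'a] \<Rightarrow> 'a"  (infixr "\<leadsto>\<index>" 60)
  zero :: 'a  ("\<zero>\<index>")
  conn :: "'c \<Rightarrow> 'a list \<Rightarrow> 'a"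

abbreviation alg_neg :: "('a, 'c, 'm) alg_scheme \<Rightarrow> 'a \<Rightarrow> 'a"  ("\<sim>\<index> _" [80] 80)
  where "\<sim>\<^bsub>A\<^esub> x \<equiv> x \<leadsto>\<^bsub>A\<^esub> \<zero>\<^bsub>A\<^esub>"

definition alg_le :: "('a, 'c, 'm) alg_scheme \<Rightarrow> 'a \<Rightarrow> 'a \<Rightarrow> bool"  (infix "\<preceq>\<index>" 50)
  where "x \<preceq>\<^bsub>A\<^esub> y \<longleftrightarrow> x \<curlywedge>\<^bsub>A\<^esub> y = x"

locale mtl_algebra = comm_monoid A for A :: "('a, 'c) alg" (structure) +
  assumes wedge_closed: "\<lbrakk>x \<in> carrier A; y \<in> carrier A\<rbrakk> \<Longrightarrow> x \<curlywedge> y \<in> carrier A"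
    and vee_closed: "\<lbrakk>x \<in> carrier A; y \<in> carrier A\<rbrakk> \<Longrightarrow> x \<curlyvee> y \<in> carrier A"
    and resid_closed: "\<lbrakk>x \<in> carrier A; y \<in> carrier A\<rbrakk> \<Longrightarrow> x \<leadsto> y \<in> carrier A"
    and zero_closed: "\<zero> \<in> carrier A"
    and wedge_comm: "\<lbrakk>x \<in> carrier A; y \<in> carrier A\<rbrakk> \<Longrightarrow> x \<curlywedge> y = y \<curlywedge> x"
    and vee_comm: "\<lbrakk>x \<in> carrier A; y \<in> carrier A\<rbrakk> \<Longrightarrow> x \<curlyvee> y = y \<curlyvee> x"
    and wedge_assoc: "\<lbrakk>x \<in> carrier A; y \<in> carrier A; z \<in> carrier A\<rbrakk>
          \<Longrightarrow> (x \<curlywedge> y) \<curlywedge> z = x \<curlywedge> (y \<curlywedge> z)"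
    and vee_assoc: "\<lbrakk>x \<in> carrier A; y \<in> carrier A; z \<in> carrier A\<rbrakk>
          \<Longrightarrow> (x \<curlyvee> y) \<curlyvee> z = x \<curlyvee> (y \<curlyvee> z)"
    and wedge_absorb: "\<lbrakk>x \<in> carrier A; y \<in> carrier A\<rbrakk> \<Longrightarrow> x \<curlywedge> (x \<curlyvee> y) = x"
    and vee_absorb: "\<lbrakk>x \<in> carrier A; y \<in> carrier A\<rbrakk> \<Longrightarrow> x \<curlyvee> (x \<curlywedge> y) = x"
    and zero_least: "x \<in> carrier A \<Longrightarrow> \<zero> \<preceq> x"
    and one_greatest: "x \<in> carrier A \<Longrightarrow> x \<preceq> \<one>"
    and residuation: "\<lbrakk>x \<in> carrier A; y \<in> carrier A; z \<in> carrier A\<rbrakk>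
          \<Longrightarrow> x \<otimes> y \<preceq> z \<longleftrightarrow> x \<preceq> y \<leadsto> z"
    and prelinearity: "\<lbrakk>x \<in> carrier A; y \<in> carrier A\<rbrakk> \<Longrightarrow> (x \<leadsto> y) \<curlyvee> (y \<leadsto> x) = \<one>"

primrec eval :: "('a, 'c) alg \<Rightarrow> (nat \<Rightarrow> 'a) \<Rightarrow> 'c fm \<Rightarrow> 'a" where
  "eval A e (Var n) = e n"
| "eval A e \<^bold>\<bottom> = \<zero>\<^bsub>A\<^esub>"
| "eval A e (\<phi> \<^bold>\<and> \<psi>) = eval A e \<phi> \<curlywedge>\<^bsub>A\<^esub> eval A e \<psi>"
| "eval A e (\<phi> \<^bold>& \<psi>) = eval A e \<phi> \<otimes>\<^bsub>A\<^esub> eval A e \<psi>"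
| "eval A e (\<phi> \<^bold>\<rightarrow> \<psi>) = eval A e \<phi> \<leadsto>\<^bsub>A\<^esub> eval A e \<psi>"
| "eval A e (Con c \<phi>s) = conn A c (map (eval A e) \<phi>s)"

definition evaluations :: "('a, 'c) alg \<Rightarrow> (nat \<Rightarrow> 'a) set"
  where "evaluations A = {e. range e \<subseteq> carrier A}"

definition L_algebra :: "'c calculus \<Rightarrow> ('a, 'c) alg \<Rightarrow> bool" where
  "L_algebra L A \<longleftrightarrow>
     mtl_algebra A \<and>
     (\<forall>c\<in>conns L. \<forall>xs. length xs = arity L c \<and> set xs \<subseteq> carrier A \<longrightarrow> conn A c xs \<in> carrier A) \<and>
     (\<forall>e\<in>evaluations A. \<forall>\<phi>\<in>axs L. eval A e \<phi> = \<one>\<^bsub>A\<^esub>) \<and>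
     (\<forall>e\<in>evaluations A. \<forall>(P, \<phi>)\<in>rules L.
        (\<forall>\<psi>\<in>P. eval A e \<psi> = \<one>\<^bsub>A\<^esub>) \<longrightarrow> eval A e \<phi> = \<one>\<^bsub>A\<^esub>)"

definition L_chain :: "'c calculus \<Rightarrow> ('a, 'c) alg \<Rightarrow> bool" where
  "L_chain L A \<longleftrightarrow>
     L_algebra L A \<and> (\<forall>x\<in>carrier A. \<forall>y\<in>carrier A. x \<preceq>\<^bsub>A\<^esub> y \<or> y \<preceq>\<^bsub>A\<^esub> x)"

definition strongly_complete :: "'c calculus \<Rightarrow> ('a, 'c) alg set \<Rightarrow> bool" where
  "strongly_complete L K \<longleftrightarrow>
     (\<forall>\<Gamma> \<phi>. \<Gamma> \<subseteq> fms L \<longrightarrow> \<phi> \<in> fms L \<longrightarrow>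
        (derives L \<Gamma> \<phi> \<longleftrightarrow>
         (\<forall>A\<in>K. \<forall>e\<in>evaluations A.
            (\<forall>\<gamma>\<in>\<Gamma>. eval A e \<gamma> = \<one>\<^bsub>A\<^esub>) \<longrightarrow> eval A e \<phi> = \<one>\<^bsub>A\<^esub>)))"

text \<open>HOL cannot quantify over all types inside a formula, so ``all chains'' becomes ``all chains
  whose carrier is a subset of the type \<open>'a\<close>''. Soundness holds over every type, so for every
  \<open>'a\<close> this property implies semilinearity in the usual sense. Conversely, a chain refuting
  \<open>\<Gamma> \<turnstile> \<phi>\<close> can be replaced by its subalgebra generated by the values of the variables, so
  the property follows from semilinearity whenever \<open>'a\<close> has at least as many elements as there
  are formulas.\<close>

definition semilinear :: "'a itself \<Rightarrow> 'c calculus \<Rightarrow> bool"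
  where "semilinear _ L \<longleftrightarrow> strongly_complete L {A :: ('a, 'c) alg. L_chain L A}"


section \<open>Expansions with a consistency operator\<close>

datatype 'c circ_conn = Old 'c | Circ

abbreviation CircF :: "'c circ_conn fm \<Rightarrow> 'c circ_conn fm"  ("\<^bold>\<circle> _" [80] 80)
  where "\<^bold>\<circle> \<phi> \<equiv> Con Circ [\<phi>]"

definition L_circ :: "'c calculus \<Rightarrow> 'c circ_conn calculus" where
  "L_circ L = (let \<phi> = Var 0; \<psi> = Var 1; \<delta> = Var 2 in
    \<lparr>conns = insert Circ (Old ` conns L),
     arity = (\<lambda>c. case c of Old c' \<Rightarrow> arity L c' | Circ \<Rightarrow> 1),
     axs = map_fm Old ` axs L \<union>
       {\<^bold>\<not> (\<phi> \<^bold>\<and> \<^bold>\<not> \<phi> \<^bold>\<and> \<^bold>\<circle> \<phi>), \<^bold>\<circle> \<^bold>\<top>, \<^bold>\<circle> \<^bold>\<bottom>},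
     rules = (\<lambda>(P, \<chi>). (map_fm Old ` P, map_fm Old \<chi>)) ` rules L \<union>
       {({(\<phi> \<^bold>\<leftrightarrow> \<psi>) \<^bold>\<or> \<delta>}, (\<^bold>\<circle> \<phi> \<^bold>\<leftrightarrow> \<^bold>\<circle> \<psi>) \<^bold>\<or> \<delta>),
        ({(\<^bold>\<not> \<^bold>\<not> \<phi> \<^bold>\<and> (\<phi> \<^bold>\<rightarrow> \<psi>)) \<^bold>\<or> \<delta>}, (\<^bold>\<circle> \<phi> \<^bold>\<rightarrow> \<^bold>\<circle> \<psi>) \<^bold>\<or> \<delta>)}\<rparr>)"

definition L_circ_min :: "'c calculus \<Rightarrow> 'c circ_conn calculus" where
  "L_circ_min L = (L_circ L)\<lparr>axs := insert (Var 0 \<^bold>\<or> \<^bold>\<not> Var 0 \<^bold>\<or> \<^bold>\<not> \<^bold>\<circle> (Var 0)) (axs (L_circ L))\<rparr>"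

text \<open>Semantically, a consistency operator is a unary operation \<open>f\<close> on an algebra \<open>A\<close> for the
  language without \<open>\<circle>\<close>; \<open>circ_expand A f\<close> is the resulting algebra for the expanded language.\<close>

definition circ_expand :: "('a, 'c) alg \<Rightarrow> ('a \<Rightarrow> 'a) \<Rightarrow> ('a, 'c circ_conn) alg" where
  "circ_expand A f =
    \<lparr>carrier = carrier A, mult = mult A, one = one A,
     wedge = wedge A, vee = vee A, resid = resid A, zero = zero A,
     conn = (\<lambda>c xs. case c of Old c' \<Rightarrow> conn A c' xs | Circ \<Rightarrow> f (hd xs))\<rparr>"

definition L_circ_chain :: "'c calculus \<Rightarrow> ('a, 'c) alg \<Rightarrow> ('a \<Rightarrow> 'a) \<Rightarrow> bool" where
  "L_circ_chain L A f \<longleftrightarrow>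
     L_chain L A \<and>
     f ` carrier A \<subseteq> carrier A \<and>
     (\<forall>x\<in>carrier A. x \<curlywedge>\<^bsub>A\<^esub> \<sim>\<^bsub>A\<^esub> x \<curlywedge>\<^bsub>A\<^esub> f x = \<zero>\<^bsub>A\<^esub>) \<and>
     f \<one>\<^bsub>A\<^esub> = \<one>\<^bsub>A\<^esub> \<and> f \<zero>\<^bsub>A\<^esub> = \<one>\<^bsub>A\<^esub> \<and>
     (\<forall>x\<in>carrier A. \<forall>y\<in>carrier A. \<forall>z\<in>carrier A.
        (\<sim>\<^bsub>A\<^esub> \<sim>\<^bsub>A\<^esub> x \<curlywedge>\<^bsub>A\<^esub> (x \<leadsto>\<^bsub>A\<^esub> y)) \<curlyvee>\<^bsub>A\<^esub> z = \<one>\<^bsub>A\<^esub> \<longrightarrow>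
        (f x \<leadsto>\<^bsub>A\<^esub> f y) \<curlyvee>\<^bsub>A\<^esub> z = \<one>\<^bsub>A\<^esub>)"

definition L_circ_min_chain :: "'c calculus \<Rightarrow> ('a, 'c) alg \<Rightarrow> ('a \<Rightarrow> 'a) \<Rightarrow> bool" where
  "L_circ_min_chain L A f \<longleftrightarrow>
     L_circ_chain L A f \<and>
     (\<forall>x\<in>carrier A. x \<curlyvee>\<^bsub>A\<^esub> \<sim>\<^bsub>A\<^esub> x \<curlyvee>\<^bsub>A\<^esub> \<sim>\<^bsub>A\<^esub> f x = \<one>\<^bsub>A\<^esub>)"

definition pointwise_least :: "'c calculus \<Rightarrow> ('a, 'c) alg \<Rightarrow> ('a \<Rightarrow> 'a) \<Rightarrow> bool" where
  "pointwise_least L A f \<longleftrightarrow>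
     (\<forall>g. L_circ_chain L A g \<longrightarrow> (\<forall>x\<in>carrier A. f x \<preceq>\<^bsub>A\<^esub> g x))"

definition zero_one_operator :: "('a, 'c) alg \<Rightarrow> ('a \<Rightarrow> 'a) \<Rightarrow> bool" where
  "zero_one_operator A f \<longleftrightarrow>
     f \<zero>\<^bsub>A\<^esub> = \<one>\<^bsub>A\<^esub> \<and> f \<one>\<^bsub>A\<^esub> = \<one>\<^bsub>A\<^esub> \<and>
     (\<forall>x\<in>carrier A. x \<noteq> \<zero>\<^bsub>A\<^esub> \<and> x \<noteq> \<one>\<^bsub>A\<^esub> \<longrightarrow> f x = \<zero>\<^bsub>A\<^esub>)"

end

theory Submission imports Defs begin

text \<open>
  Write \<open>L\<close> for the base logic and \<open>M\<close> for its minimal expansion by \<open>\<circle>\<close>. On a chain a join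
  equals \<open>1\<close> only if one of the joined elements does, so the axiom \<open>\<phi> \<or> \<not> \<phi> \<or> \<not> \<circle> \<phi>\<close> says that \<open>\<circle> x = 0\<close>
  for every \<open>x\<close> other than \<open>0\<close> and \<open>1\<close>. This operator always satisfies the conditions on a
  consistency operator: the premise of the coherence rule makes \<open>\<not> x = 0\<close> and \<open>x \<le> y\<close>, so if
  \<open>\<circle> x\<close> is not \<open>0\<close> then \<open>x = 1 = y\<close>. Since every consistency operator is \<open>1\<close> at \<open>0\<close> and at
  \<open>1\<close>, it is the least one (\<open>circ_min_chain_iff_zero_one\<close>, \<open>circ_min_chain_iff_least\<close>).

  Completeness is a Lindenbaum construction. Everything that has to be derived in the
  process is a substitution instance of a consequence of \<open>L\<close>, and by semilinearity such a
  consequence holds as soon as it is valid on \<open>L\<close>-chains (\<open>chain_consequence\<close>). On chains,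
  validity is a matter of comparing elements, so no Hilbert-style derivations are needed.

  The decisive property of \<open>M\<close> is proof by cases: what follows from \<open>a\<close> and from \<open>b\<close> follows
  from \<open>a \<or> b\<close>. It holds because a derivation remains one when a disjunct \<open>\<delta>\<close> is added to every
  formula in it (\<open>derives_join\<close>). For a rule of \<open>L\<close>, adding a fresh variable as disjunct to premises
  and conclusion preserves validity on chains, hence gives a derived rule
  (\<open>old_rule_join\<close>); the two rules for \<open>\<circle>\<close> carry a side disjunct already.

  If \<open>\<phi>\<close> is not derivable from \<open>\<Gamma>\<close>, a maximal extension of \<open>\<Gamma>\<close> that does not derive \<open>\<phi>\<close> is therefore
  prime (\<open>prime_extension\<close>). Its Lindenbaum algebra is linearly ordered by primeness and
  prelinearity, is an \<open>L\<close>-chain, and carries the operator induced by \<open>\<circle>\<close>, which satisfies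
  the axioms and rules for \<open>\<circle>\<close> because the extension is closed under them
  (\<open>lind_circ_min_chain\<close>). The classes of the variables refute \<open>\<phi>\<close>.
\<close>

section \<open>Chains of MTL\<close>

text \<open>In a chain \<open>\<curlywedge>\<close> and \<open>\<curlyvee>\<close> are minimum and maximum, and \<open>x \<leadsto> y = \<one>\<close> means \<open>x \<preceq> y\<close>; the rewrite rules
  below reduce the validity of formulas to statements about the order.\<close>
locale mtl_chain = mtl_algebra +
  assumes total: "\<lbrakk>x \<in> carrier A; y \<in> carrier A\<rbrakk> \<Longrightarrow> x \<preceq> y \<or> y \<preceq> x"
begin

lemmas closed [simp, intro] = wedge_closed vee_closed resid_closed zero_closed m_closed one_closed

lemmas bounds = zero_least one_greatest
lemmas laws = m_assoc m_comm l_one wedge_comm vee_comm wedge_assoc vee_assoc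
  wedge_absorb vee_absorb prelinearity

lemma le_refl [simp]: "x \<in> carrier A \<Longrightarrow> x \<preceq> x"
  unfolding alg_le_def by (metis vee_absorb wedge_absorb wedge_closed)

lemma le_antisym: "\<lbrakk>x \<preceq> y; y \<preceq> x; x \<in> carrier A; y \<in> carrier A\<rbrakk> \<Longrightarrow> x = y"
  unfolding alg_le_def by (metis wedge_comm)

lemma le_trans: "\<lbrakk>x \<preceq> y; y \<preceq> z; x \<in> carrier A; y \<in> carrier A; z \<in> carrier A\<rbrakk> \<Longrightarrow> x \<preceq> z"
  unfolding alg_le_def by (metis wedge_assoc)

lemma resid_one_iff [simp]:
  "\<lbrakk>x \<in> carrier A; y \<in> carrier A\<rbrakk> \<Longrightarrow> x \<leadsto> y = \<one> \<longleftrightarrow> x \<preceq> y"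
  using residuation[of \<one> x y] one_greatest[of "x \<leadsto> y"] le_antisym[of "x \<leadsto> y" \<one>]
  by (auto simp: resid_closed)

lemma one_resid [simp]: "y \<in> carrier A \<Longrightarrow> \<one> \<leadsto> y = y"
  by (metis le_antisym le_refl one_closed r_one resid_closed residuation)

lemma wedge_if: "\<lbrakk>x \<in> carrier A; y \<in> carrier A\<rbrakk> \<Longrightarrow> x \<curlywedge> y = (if x \<preceq> y then x else y)"
  using total[of x y] wedge_comm[of x y] by (auto simp: alg_le_def)

lemma vee_if: "\<lbrakk>x \<in> carrier A; y \<in> carrier A\<rbrakk> \<Longrightarrow> x \<curlyvee> y = (if x \<preceq> y then y else x)"
  using total[of x y] vee_absorb[of x y] vee_absorb[of y x] wedge_comm[of x y] vee_comm[of x y]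
  by (auto simp: alg_le_def)

lemma one_le_iff [simp]: "x \<in> carrier A \<Longrightarrow> \<one> \<preceq> x \<longleftrightarrow> x = \<one>"
  using one_greatest le_antisym by fastforce

lemma le_zero_iff [simp]: "x \<in> carrier A \<Longrightarrow> x \<preceq> \<zero> \<longleftrightarrow> x = \<zero>"
  using zero_least le_antisym by fastforce

lemma wedge_one_iff [simp]:
  "\<lbrakk>x \<in> carrier A; y \<in> carrier A\<rbrakk> \<Longrightarrow> x \<curlywedge> y = \<one> \<longleftrightarrow> x = \<one> \<and> y = \<one>"
  by (auto simp: wedge_if one_greatest)

lemma vee_one_iff [simp]:
  "\<lbrakk>x \<in> carrier A; y \<in> carrier A\<rbrakk> \<Longrightarrow> x \<curlyvee> y = \<one> \<longleftrightarrow> x = \<one> \<or> y = \<one>"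
  by (auto simp: vee_if one_greatest)

lemma zero_resid [simp]: "x \<in> carrier A \<Longrightarrow> \<zero> \<leadsto> x = \<one>"
  by (simp add: zero_least)

lemma le_if_zero_eq_one: "\<lbrakk>\<zero> = \<one>; x \<in> carrier A; y \<in> carrier A\<rbrakk> \<Longrightarrow> x \<preceq> y"
  using le_trans[of x \<one> y] zero_least[of y] one_greatest[of x] by auto

lemma le_wedge_iff: "\<lbrakk>x \<in> carrier A; y \<in> carrier A; z \<in> carrier A\<rbrakk>
   \<Longrightarrow> z \<preceq> x \<curlywedge> y \<longleftrightarrow> z \<preceq> x \<and> z \<preceq> y"
  using total[of x y] by (auto simp: wedge_if dest: le_trans)

lemma wedge_le: "\<lbrakk>x \<in> carrier A; y \<in> carrier A\<rbrakk> \<Longrightarrow> x \<curlywedge> y \<preceq> x"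
                "\<lbrakk>x \<in> carrier A; y \<in> carrier A\<rbrakk> \<Longrightarrow> x \<curlywedge> y \<preceq> y"
  using le_wedge_iff[of x y "x \<curlywedge> y"] by auto

lemma modus_ponens_le:
  assumes "x \<in> carrier A" "y \<in> carrier A"
  shows "x \<otimes> (x \<leadsto> y) \<preceq> y"
  using assms residuation[of "x \<leadsto> y" x y] by (simp add: m_comm)

lemma mult_mono:
  assumes "x \<preceq> x'" "x \<in> carrier A" "x' \<in> carrier A" "y \<in> carrier A"
  shows "x \<otimes> y \<preceq> x' \<otimes> y"
  using assms by (meson closed(5) le_refl le_trans resid_closed residuation)

lemma mult_le: "\<lbrakk>x \<in> carrier A; y \<in> carrier A\<rbrakk> \<Longrightarrow> x \<otimes> y \<preceq> x"
                "\<lbrakk>x \<in> carrier A; y \<in> carrier A\<rbrakk> \<Longrightarrow> x \<otimes> y \<preceq> y"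
  using mult_mono[of y \<one> x] mult_mono[of x \<one> y] one_greatest by (auto simp: m_comm)

text \<open>If \<open>x \<preceq> y\<close>, the first factor is \<open>\<one> \<leadsto> y = y\<close>, and it is below the second because
  \<open>y \<otimes> (y \<leadsto> x) \<preceq> x\<close>. The other case is symmetric.\<close>
lemma join_eq [simp]:
  assumes "x \<in> carrier A" "y \<in> carrier A"
  shows "((x \<leadsto> y) \<leadsto> y) \<curlywedge> ((y \<leadsto> x) \<leadsto> x) = x \<curlyvee> y"
proof -
  have *: "((x \<leadsto> y) \<leadsto> y) \<curlywedge> ((y \<leadsto> x) \<leadsto> x) = y \<and> x \<curlyvee> y = y"
    if "x \<preceq> y" "x \<in> carrier A" "y \<in> carrier A" for x y
  proof -
    have "(x \<leadsto> y) \<leadsto> y = y" using that by (metis one_resid resid_one_iff)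
    moreover have "y \<preceq> (y \<leadsto> x) \<leadsto> x"
      using that modus_ponens_le[of y x] by (simp add: residuation[symmetric])
    ultimately show ?thesis using that by (simp add: wedge_if vee_if)
  qed
  show ?thesis
    using total[OF assms] *[of x y] *[of y x] assms wedge_comm vee_comm by (metis closed(1,3))
qed

lemma resid_trans:
  assumes "x \<in> carrier A" "y \<in> carrier A" "z \<in> carrier A"
  shows "x \<leadsto> y \<preceq> (y \<leadsto> z) \<leadsto> (x \<leadsto> z)"
proof -
  have "x \<otimes> (x \<leadsto> y) \<otimes> (y \<leadsto> z) \<preceq> y \<otimes> (y \<leadsto> z)"
    using assms by (intro mult_mono modus_ponens_le) auto
  hence "x \<otimes> (x \<leadsto> y) \<otimes> (y \<leadsto> z) \<preceq> z"
    by (rule le_trans) (use assms modus_ponens_le in auto)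
  thus ?thesis
    using assms by (simp add: residuation[symmetric] m_ac)
qed

lemma resid_curry:
  assumes "x \<in> carrier A" "y \<in> carrier A" "z \<in> carrier A"
  shows "x \<otimes> y \<leadsto> z = x \<leadsto> (y \<leadsto> z)"
proof (rule le_antisym)
  have "(x \<otimes> y) \<otimes> (x \<otimes> y \<leadsto> z) \<preceq> z" using assms by (intro modus_ponens_le) auto
  thus "x \<otimes> y \<leadsto> z \<preceq> x \<leadsto> (y \<leadsto> z)" using assms by (simp add: residuation[symmetric] m_ac)
  have "x \<otimes> (x \<leadsto> (y \<leadsto> z)) \<preceq> y \<leadsto> z" using assms by (intro modus_ponens_le) auto
  thus "x \<leadsto> (y \<leadsto> z) \<preceq> x \<otimes> y \<leadsto> z" using assms by (simp add: residuation[symmetric] m_ac)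
qed (use assms in auto)

lemma mtl_axs_valid:
  assumes "\<phi> \<in> mtl_axs" "e \<in> evaluations A"
  shows "eval A e \<phi> = \<one>"
proof -
  have c: "e n \<in> carrier A" for n using assms(2) by (auto simp: evaluations_def)
  have curry: "x \<otimes> y \<leadsto> z \<preceq> x \<leadsto> (y \<leadsto> z)" "x \<leadsto> (y \<leadsto> z) \<preceq> x \<otimes> y \<leadsto> z"
    if "x \<in> carrier A" "y \<in> carrier A" "z \<in> carrier A" for x y z
    using that by (simp_all add: resid_curry)
  \<comment> \<open>one of the two implications is \<open>\<one>\<close>, and then the corresponding hypothesis is \<open>z\<close> itself\<close>
  have prelin: "(x \<leadsto> y) \<leadsto> z \<preceq> ((y \<leadsto> x) \<leadsto> z) \<leadsto> z"
    if "x \<in> carrier A" "y \<in> carrier A" "z \<in> carrier A" for x y z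
  proof (cases "x \<preceq> y")
    case True
    hence "(x \<leadsto> y) \<leadsto> z = z" using that by (metis one_resid resid_one_iff)
    thus ?thesis using that by (simp add: residuation[symmetric] mult_le)
  next
    case False
    hence "(y \<leadsto> x) \<leadsto> z = z" using that total by (metis one_resid resid_one_iff)
    thus ?thesis using that by (simp add: residuation[symmetric] mult_le)
  qed
  from assms(1) show ?thesis
    unfolding mtl_axs_def Let_def
    by (auto simp: c resid_trans curry mult_le wedge_le le_wedge_iff prelin zero_least
        modus_ponens_le m_comm wedge_comm)
qed

end

lemma L_chain_mtl_chain: "L_chain L A \<Longrightarrow> mtl_chain A"
  by (simp add: L_chain_def L_algebra_def mtl_chain_def mtl_chain_axioms_def)

section \<open>Derivations in a calculus\<close>

lemma subst_subst: "subst \<sigma> (subst \<tau> \<phi>) = subst (\<lambda>n. subst \<sigma> (\<tau> n)) \<phi>"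
  by (induction \<phi>) auto

lemma map_fm_subst: "map_fm f (subst \<tau> \<phi>) = subst (\<lambda>n. map_fm f (\<tau> n)) (map_fm f \<phi>)"
  by (induction \<phi>) auto

lemma subst_fm: "\<lbrakk>\<phi> \<in> fms N; range \<sigma> \<subseteq> fms N\<rbrakk> \<Longrightarrow> subst \<sigma> \<phi> \<in> fms N"
  by (induction \<phi>) (auto simp: fms_def list_all_iff)

lemma eval_subst: "eval A e (subst \<sigma> \<phi>) = eval A (\<lambda>n. eval A e (\<sigma> n)) \<phi>"
proof (induction \<phi>)
  case (Con c \<phi>s)
  thus ?case by (simp add: o_def cong: map_cong)
qed auto

lemma eval_closed:
  assumes "L_algebra N A" "e \<in> evaluations A"
  shows "\<phi> \<in> fms N \<Longrightarrow> eval A e \<phi> \<in> carrier A"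
proof -
  interpret mtl_algebra A using assms by (simp add: L_algebra_def)
  have e: "e n \<in> carrier A" for n using assms(2) by (auto simp: evaluations_def)
  have c: "conn A c xs \<in> carrier A"
    if "c \<in> conns N" "length xs = arity N c" "set xs \<subseteq> carrier A" for c xs
    using assms(1) that by (auto simp: L_algebra_def)
  show "\<phi> \<in> fms N \<Longrightarrow> eval A e \<phi> \<in> carrier A"
    by (induction \<phi>)
      (auto simp: fms_def list_all_iff e zero_closed wedge_closed resid_closed intro!: c)
qed

text \<open>The two conditions keep derivations inside the language of the calculus and make them
  depend on finitely many hypotheses.\<close>
definition well_formed :: "'c calculus \<Rightarrow> bool" where
  "well_formed N \<longleftrightarrow> axs N \<subseteq> fms N \<and> (\<forall>(P, \<phi>)\<in>rules N. finite P \<and> P \<subseteq> fms N \<and> \<phi> \<in> fms N)"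

lemma mtl_axs_fms: "mtl_axs \<subseteq> fms N"
  by (auto simp: mtl_axs_def Let_def fms_def)

lemma derives_fm:
  assumes "derives N \<Gamma> \<phi>" "well_formed N" "\<Gamma> \<subseteq> fms N"
  shows "\<phi> \<in> fms N"
  using assms(1)
proof induction
  case (ax \<phi> \<sigma>)
  thus ?case using assms(2) mtl_axs_fms[of N] by (intro subst_fm) (auto simp: well_formed_def)
next
  case (mp \<phi> \<psi>)
  thus ?case by (simp add: fms_def)
next
  case (rl P \<phi> \<sigma>)
  thus ?case using assms(2) by (intro subst_fm) (auto simp: well_formed_def)
qed (use assms(3) in auto)

lemma derives_cut:
  assumes "derives N \<Gamma> \<phi>" "\<And>\<gamma>. \<gamma> \<in> \<Gamma> \<Longrightarrow> derives N \<Delta> \<gamma>"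
  shows "derives N \<Delta> \<phi>"
  using assms(1)
proof induction
  case (rl P \<phi> \<sigma>)
  thus ?case by (intro derives.rl) auto
qed (use assms(2) in \<open>auto intro: derives.ax derives.mp\<close>)

lemma derives_compact:
  assumes "derives N \<Gamma> \<phi>" "well_formed N"
  shows "\<exists>\<Delta>. finite \<Delta> \<and> \<Delta> \<subseteq> \<Gamma> \<and> derives N \<Delta> \<phi>"
  using assms(1)
proof induction
  case (hyp \<phi>)
  thus ?case by (intro exI[of _ "{\<phi>}"]) (auto intro: derives.hyp)
next
  case (ax \<phi> \<sigma>)
  thus ?case by (intro exI[of _ "{}"]) (auto intro: derives.ax)
next
  case (mp \<phi> \<psi>)
  then obtain D1 D2 where "finite D1" "D1 \<subseteq> \<Gamma>" "derives N D1 \<phi>"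
    "finite D2" "D2 \<subseteq> \<Gamma>" "derives N D2 (\<phi> \<^bold>\<rightarrow> \<psi>)" by auto
  thus ?case
    by (intro exI[of _ "D1 \<union> D2"])
      (auto intro!: derives.mp[of _ _ \<phi> \<psi>] intro: derives_cut derives.hyp)
next
  case (rl P \<phi> \<sigma>)
  from rl(3) obtain D where D: "\<And>\<psi>. \<psi> \<in> P \<Longrightarrow> finite (D \<psi>) \<and> D \<psi> \<subseteq> \<Gamma> \<and> derives N (D \<psi>) (subst \<sigma> \<psi>)"
    by metis
  have "finite P" using rl(1) assms(2) by (auto simp: well_formed_def)
  moreover have "derives N (\<Union>(D ` P)) (subst \<sigma> \<psi>)" if "\<psi> \<in> P" for \<psi>
    by (rule derives_cut[of N "D \<psi>"]) (use D[OF that] that in \<open>auto intro: derives.hyp\<close>)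
  hence "derives N (\<Union>(D ` P)) (subst \<sigma> \<phi>)" by (intro derives.rl[OF rl(1,2)]) auto
  ultimately show ?case using D by (intro exI[of _ "\<Union>(D ` P)"]) auto
qed

lemma derives_sound:
  assumes "derives N \<Gamma> \<phi>" "L_chain N A" "well_formed N" "\<Gamma> \<subseteq> fms N"
    "e \<in> evaluations A" "\<And>\<gamma>. \<gamma> \<in> \<Gamma> \<Longrightarrow> eval A e \<gamma> = \<one>\<^bsub>A\<^esub>"
  shows "eval A e \<phi> = \<one>\<^bsub>A\<^esub>"
proof -
  interpret mtl_chain A by (rule L_chain_mtl_chain[OF assms(2)])
  have alg: "L_algebra N A" using assms(2) by (simp add: L_chain_def)
  have ev: "(\<lambda>n. eval A e (\<sigma> n)) \<in> evaluations A" if "range \<sigma> \<subseteq> fms N" for \<sigma>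
    using that eval_closed[OF alg assms(5)] by (auto simp: evaluations_def)
  show ?thesis using assms(1)
  proof induction
    case (ax \<phi> \<sigma>)
    thus ?case using alg ev[of \<sigma>] mtl_axs_valid by (auto simp: eval_subst L_algebra_def)
  next
    case (mp \<phi> \<psi>)
    hence "\<phi> \<^bold>\<rightarrow> \<psi> \<in> fms N" using derives_fm assms(3,4) by blast
    hence "eval A e \<psi> \<in> carrier A" by (intro eval_closed[OF alg assms(5)]) (simp add: fms_def)
    thus ?case using mp by (metis eval.simps(5) one_resid)
  next
    case (rl P \<phi> \<sigma>)
    thus ?case using alg ev[of \<sigma>] unfolding L_algebra_def by (fastforce simp: eval_subst)
  qed (use assms(6) in auto)
qed

section \<open>Transfer of consequences from the base logic\<close>

abbreviation old :: "'c fm \<Rightarrow> 'c circ_conn fm" where "old \<equiv> map_fm Old"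

lemma old_fm: "is_fm (L_circ_min L) (old \<phi>) \<longleftrightarrow> is_fm L \<phi>"
  by (induction \<phi>) (auto simp: L_circ_min_def L_circ_def Let_def list_all_iff)

lemma signature_min [simp]:
  "Circ \<in> conns (L_circ_min L)" "arity (L_circ_min L) Circ = 1"
  "Old c \<in> conns (L_circ_min L) \<longleftrightarrow> c \<in> conns L" "arity (L_circ_min L) (Old c) = arity L c"
  by (auto simp: L_circ_min_def L_circ_def Let_def)

lemma old_mtl_axs: "\<phi> \<in> mtl_axs \<Longrightarrow> old \<phi> \<in> mtl_axs"
  by (auto simp: mtl_axs_def Let_def)

lemma axs_min: "axs (L_circ_min L) = old ` axs L \<union>
   {\<^bold>\<not> (Var 0 \<^bold>\<and> \<^bold>\<not> Var 0 \<^bold>\<and> \<^bold>\<circle> (Var 0)), \<^bold>\<circle> \<^bold>\<top>, \<^bold>\<circle> \<^bold>\<bottom>,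
    Var 0 \<^bold>\<or> \<^bold>\<not> Var 0 \<^bold>\<or> \<^bold>\<not> \<^bold>\<circle> (Var 0)}"
  by (auto simp: L_circ_min_def L_circ_def Let_def)

lemma rules_min: "rules (L_circ_min L) = (\<lambda>(P, \<chi>). (old ` P, old \<chi>)) ` rules L \<union>
   {({(Var 0 \<^bold>\<leftrightarrow> Var 1) \<^bold>\<or> Var 2}, (\<^bold>\<circle> (Var 0) \<^bold>\<leftrightarrow> \<^bold>\<circle> (Var 1)) \<^bold>\<or> Var 2),
    ({(\<^bold>\<not> \<^bold>\<not> (Var 0) \<^bold>\<and> (Var 0 \<^bold>\<rightarrow> Var 1)) \<^bold>\<or> Var 2}, (\<^bold>\<circle> (Var 0) \<^bold>\<rightarrow> \<^bold>\<circle> (Var 1)) \<^bold>\<or> Var 2)}"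
  by (simp add: L_circ_min_def L_circ_def Let_def)

lemma well_formed_min:
  assumes "core_expansion L"
  shows "well_formed (L_circ_min L)"
  unfolding well_formed_def
proof (intro conjI ballI)
  show "axs (L_circ_min L) \<subseteq> fms (L_circ_min L)"
    using assms by (auto simp: axs_min core_expansion_def fms_def old_fm)
  fix r assume "r \<in> rules (L_circ_min L)"
  then consider P \<phi> where "(P, \<phi>) \<in> rules L" "r = (old ` P, old \<phi>)"
    | "r = ({(Var 0 \<^bold>\<leftrightarrow> Var 1) \<^bold>\<or> Var 2}, (\<^bold>\<circle> (Var 0) \<^bold>\<leftrightarrow> \<^bold>\<circle> (Var 1)) \<^bold>\<or> Var 2)"
    | "r = ({(\<^bold>\<not> \<^bold>\<not> (Var 0) \<^bold>\<and> (Var 0 \<^bold>\<rightarrow> Var 1)) \<^bold>\<or> Var 2}, (\<^bold>\<circle> (Var 0) \<^bold>\<rightarrow> \<^bold>\<circle> (Var 1)) \<^bold>\<or> Var 2)"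
    unfolding rules_min by auto
  thus "case r of (P, \<phi>) \<Rightarrow> finite P \<and> P \<subseteq> fms (L_circ_min L) \<and> \<phi> \<in> fms (L_circ_min L)"
  proof cases
    case 1
    hence "finite P \<and> P \<subseteq> fms L \<and> \<phi> \<in> fms L" using assms by (auto simp: core_expansion_def)
    thus ?thesis using 1 by (auto simp: fms_def old_fm)
  qed (auto simp: fms_def)
qed

text \<open>A derivation in the base logic, with \<open>\<sigma>\<close> applied to every formula in it, is a derivation in the
  expansion: instances of schemata compose with \<open>\<sigma>\<close>.\<close>
lemma derives_transfer:
  assumes "derives L \<Gamma> \<phi>" "range \<sigma> \<subseteq> fms (L_circ_min L)"
    "\<And>\<gamma>. \<gamma> \<in> \<Gamma> \<Longrightarrow> derives (L_circ_min L) T (subst \<sigma> (old \<gamma>))"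
  shows "derives (L_circ_min L) T (subst \<sigma> (old \<phi>))"
proof -
  have rg: "range (\<lambda>n. subst \<sigma> (old (\<tau> n))) \<subseteq> fms (L_circ_min L)" if "range \<tau> \<subseteq> fms L" for \<tau>
    using that assms(2) by (auto simp: fms_def old_fm intro!: subst_fm[unfolded fms_def, simplified])
  show ?thesis using assms(1)
  proof induction
    case (ax \<phi> \<tau>)
    have "old \<phi> \<in> mtl_axs \<union> axs (L_circ_min L)"
      using ax old_mtl_axs by (auto simp: axs_min)
    from derives.ax[OF this rg[OF ax(2)]] show ?case by (simp add: map_fm_subst subst_subst)
  next
    case (mp \<phi> \<psi>)
    thus ?case by (auto intro: derives.mp)
  next
    case (rl P \<phi> \<tau>)
    have "(old ` P, old \<phi>) \<in> rules (L_circ_min L)"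
      using rl by (force simp: rules_min)
    from derives.rl[OF this rg[OF rl(2)], of T] show ?case
      using rl(3) by (simp add: map_fm_subst subst_subst)
  qed (use assms(3) in auto)
qed

text \<open>Beyond the list the value is \<open>\<bottom>\<close>, so that the substitution takes values in every language
  that contains the list.\<close>
definition inst :: "'c fm list \<Rightarrow> nat \<Rightarrow> 'c fm" where
  "inst xs n = (if n < length xs then xs ! n else \<^bold>\<bottom>)"

lemma range_inst: "set \<psi>s \<subseteq> fms N \<Longrightarrow> range (inst \<psi>s) \<subseteq> fms N"
  using nth_mem by (fastforce simp: inst_def fms_def)

lemmas chain_simps = mtl_chain.closed mtl_chain.join_eq mtl_chain.vee_one_iff mtl_chain.wedge_one_iff
  mtl_chain.resid_one_iff mtl_chain.one_resid mtl_chain.one_le_iff mtl_chain.le_refl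
  mtl_chain.zero_resid mtl_chain.bounds

locale semilinear_core_expansion =
  fixes L :: "'c calculus" and ty :: "'a itself"
  assumes core: "core_expansion L" and semi: "semilinear ty L"
begin

abbreviation M where "M \<equiv> L_circ_min L"

lemma wf_M: "well_formed M" by (rule well_formed_min[OF core])

text \<open>Semilinearity provides the derivation in the base logic, and it is then carried over to the
  expansion. This replaces all syntactic derivations in the sequel.\<close>
lemma chain_consequence:
  assumes "\<And>(A :: ('a, 'c) alg) e. \<lbrakk>L_chain L A; mtl_chain A; e \<in> evaluations A;
      \<And>n. e n \<in> carrier A; \<And>\<gamma>. \<gamma> \<in> \<Gamma> \<Longrightarrow> eval A e \<gamma> = \<one>\<^bsub>A\<^esub>\<rbrakk> \<Longrightarrow> eval A e \<phi> = \<one>\<^bsub>A\<^esub>"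
    and "\<Gamma> \<subseteq> fms L" "\<phi> \<in> fms L" "range \<sigma> \<subseteq> fms M"
    and "\<And>\<gamma>. \<gamma> \<in> \<Gamma> \<Longrightarrow> derives M T (subst \<sigma> (old \<gamma>))"
  shows "derives M T (subst \<sigma> (old \<phi>))"
proof (rule derives_transfer[OF _ assms(4,5)])
  show "derives L \<Gamma> \<phi>"
  proof -
    have "eval A e \<phi> = \<one>\<^bsub>A\<^esub>"
      if "L_chain L A" "e \<in> evaluations A" "\<forall>\<gamma>\<in>\<Gamma>. eval A e \<gamma> = \<one>\<^bsub>A\<^esub>"
      for A :: "('a, 'c) alg" and e
      using that L_chain_mtl_chain[OF that(1)] by (intro assms(1)) (auto simp: evaluations_def)
    with semi assms(2,3) show ?thesis unfolding semilinear_def strongly_complete_def by blast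
  qed
qed

lemma mtl_consequence:
  assumes "\<And>(A :: ('a, 'c) alg) e. \<lbrakk>mtl_chain A; \<And>n. e n \<in> carrier A;
      \<forall>\<gamma>\<in>\<Gamma>. eval A e \<gamma> = \<one>\<^bsub>A\<^esub>\<rbrakk> \<Longrightarrow> eval A e \<phi> = \<one>\<^bsub>A\<^esub>"
    and "\<forall>\<gamma>\<in>\<Gamma>. derives M T (subst (inst \<psi>s) (old \<gamma>))"
    and "\<Gamma> \<subseteq> fms L" "\<phi> \<in> fms L" "set \<psi>s \<subseteq> fms M"
  shows "derives M T (subst (inst \<psi>s) (old \<phi>))"
  by (rule chain_consequence[OF _ assms(3,4) range_inst[OF assms(5)]])
    (use assms(1,2) in auto)

section \<open>Proof by cases and prime extensions\<close>

lemma join_intro: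
  assumes "derives M T a" "a \<in> fms M" "b \<in> fms M"
  shows "derives M T (a \<^bold>\<or> b)"
proof -
  have "derives M T (subst (inst [a, b]) (old (Var 0 \<^bold>\<or> Var 1)))"
    by (rule mtl_consequence[of "{Var 0}"])
      (use assms in \<open>auto simp: inst_def fms_def chain_simps\<close>)
  thus ?thesis by (simp add: inst_def)
qed

lemma join_mp:
  assumes "derives M T (a \<^bold>\<or> d)" "derives M T ((a \<^bold>\<rightarrow> b) \<^bold>\<or> d)" "a \<in> fms M" "b \<in> fms M" "d \<in> fms M"
  shows "derives M T (b \<^bold>\<or> d)"
proof -
  have "derives M T (subst (inst [a, b, d]) (old (Var 1 \<^bold>\<or> Var 2)))"
    by (rule mtl_consequence[of "{Var 0 \<^bold>\<or> Var 2, (Var 0 \<^bold>\<rightarrow> Var 1) \<^bold>\<or> Var 2}"])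
      (use assms in \<open>auto simp: inst_def fms_def chain_simps\<close>)
  thus ?thesis by (simp add: inst_def)
qed

lemma join_comm:
  assumes "derives M T (a \<^bold>\<or> b)" "a \<in> fms M" "b \<in> fms M"
  shows "derives M T (b \<^bold>\<or> a)"
proof -
  have "derives M T (subst (inst [a, b]) (old (Var 1 \<^bold>\<or> Var 0)))"
    by (rule mtl_consequence[of "{Var 0 \<^bold>\<or> Var 1}"])
      (use assms in \<open>auto simp: inst_def fms_def chain_simps\<close>)
  thus ?thesis by (simp add: inst_def)
qed

lemma join_assoc:
  assumes "a \<in> fms M" "b \<in> fms M" "c \<in> fms M"
  shows "derives M T ((a \<^bold>\<or> b) \<^bold>\<or> c) \<longleftrightarrow> derives M T (a \<^bold>\<or> (b \<^bold>\<or> c))"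
proof
  assume "derives M T ((a \<^bold>\<or> b) \<^bold>\<or> c)"
  hence "derives M T (subst (inst [a, b, c]) (old (Var 0 \<^bold>\<or> Var 1 \<^bold>\<or> Var 2)))"
    by (intro mtl_consequence[of "{(Var 0 \<^bold>\<or> Var 1) \<^bold>\<or> Var 2}"])
      (use assms in \<open>auto simp: inst_def fms_def chain_simps\<close>)
  thus "derives M T (a \<^bold>\<or> (b \<^bold>\<or> c))" by (simp add: inst_def)
next
  assume "derives M T (a \<^bold>\<or> (b \<^bold>\<or> c))"
  hence "derives M T (subst (inst [a, b, c]) (old ((Var 0 \<^bold>\<or> Var 1) \<^bold>\<or> Var 2)))"
    by (intro mtl_consequence[of "{Var 0 \<^bold>\<or> Var 1 \<^bold>\<or> Var 2}"])
      (use assms in \<open>auto simp: inst_def fms_def chain_simps\<close>)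
  thus "derives M T ((a \<^bold>\<or> b) \<^bold>\<or> c)" by (simp add: inst_def)
qed

lemma join_idem:
  assumes "derives M T (a \<^bold>\<or> a)" "a \<in> fms M"
  shows "derives M T a"
proof -
  have "derives M T (subst (inst [a]) (old (Var 0)))"
    by (rule mtl_consequence[of "{Var 0 \<^bold>\<or> Var 0}"])
      (use assms in \<open>auto simp: inst_def fms_def chain_simps\<close>)
  thus ?thesis by (simp add: inst_def)
qed

text \<open>Shift the variables of the rule by one, which frees \<open>Var 0\<close> for the new disjunct. The rule obtained
  is valid on chains: if the value of \<open>Var 0\<close> is not \<open>1\<close>, all premises of the original rule have
  value \<open>1\<close>.\<close>
lemma old_rule_join:
  assumes "(P, \<phi>) \<in> rules L" "range \<sigma> \<subseteq> fms M" "\<delta> \<in> fms M"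
    "\<And>p. p \<in> P \<Longrightarrow> derives M T (subst \<sigma> (old p) \<^bold>\<or> \<delta>)"
  shows "derives M T (subst \<sigma> (old \<phi>) \<^bold>\<or> \<delta>)"
proof -
  define shift where "shift = (subst (\<lambda>n. Var (Suc n)) :: 'c fm \<Rightarrow> 'c fm)"
  define \<tau> where "\<tau> = case_nat \<delta> \<sigma>"
  have sh: "subst \<tau> (old (shift p)) = subst \<sigma> (old p)" for p
    by (simp add: shift_def \<tau>_def map_fm_subst subst_subst)
  have fm: "shift p \<in> fms L" if "p \<in> fms L" for p
    using that unfolding shift_def by (rule subst_fm) (auto simp: fms_def)
  have P: "P \<subseteq> fms L" "\<phi> \<in> fms L" using core assms(1) by (auto simp: core_expansion_def)
  have "derives M T (subst \<tau> (old (shift \<phi> \<^bold>\<or> Var 0)))"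
  proof (rule chain_consequence[of "(\<lambda>p. shift p \<^bold>\<or> Var 0) ` P"], goal_cases)
    case (1 A e)
    have alg: "L_algebra L A" using 1(1) by (simp add: L_chain_def)
    interpret mtl_chain A by fact
    have cl: "eval A e (shift p) \<in> carrier A" if "p \<in> fms L" for p
      using eval_closed[OF alg 1(3) fm[OF that]] .
    have "eval A e (shift \<phi>) = \<one>\<^bsub>A\<^esub> \<or> e 0 = \<one>\<^bsub>A\<^esub>"
    proof (rule disjCI)
      assume "e 0 \<noteq> \<one>\<^bsub>A\<^esub>"
      moreover have "eval A e (shift p) \<curlyvee>\<^bsub>A\<^esub> e 0 = \<one>\<^bsub>A\<^esub>" if "p \<in> P" for p
        using 1(5)[of "shift p \<^bold>\<or> Var 0"] that 1(4) cl P by auto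
      ultimately have "\<forall>p\<in>P. eval A e (shift p) = \<one>\<^bsub>A\<^esub>"
        using vee_one_iff cl P(1) 1(4) by blast
      moreover have "(\<lambda>n. e (Suc n)) \<in> evaluations A"
        using 1(4) by (auto simp: evaluations_def)
      ultimately show "eval A e (shift \<phi>) = \<one>\<^bsub>A\<^esub>"
        using alg assms(1) unfolding L_algebra_def shift_def by (fastforce simp: eval_subst)
    qed
    thus ?case using cl P(2) 1(4) by simp
  next
    case 4
    show ?case using assms(2,3) by (auto simp: \<tau>_def image_subset_iff split: nat.splits)
  next
    case (5 \<gamma>)
    then show ?case using assms(4) by (auto simp: sh) (simp add: \<tau>_def)
  qed (use fm P in \<open>auto simp: fms_def\<close>)
  thus ?thesis by (simp add: sh) (simp add: \<tau>_def)
qed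

text \<open>By induction on the derivation: an axiom implies its disjunction with \<open>\<delta>\<close>, and modus ponens and all rules
  remain derivable with \<open>\<delta>\<close> added to premises and conclusion.\<close>
lemma derives_join:
  assumes "derives M \<Gamma> \<phi>" "\<Gamma> \<subseteq> fms M" "\<delta> \<in> fms M" "\<And>\<gamma>. \<gamma> \<in> \<Gamma> \<Longrightarrow> derives M T (\<gamma> \<^bold>\<or> \<delta>)"
  shows "derives M T (\<phi> \<^bold>\<or> \<delta>)"
  using assms(1)
proof induction
  case (ax \<phi> \<sigma>)
  have "derives M {} (subst \<sigma> \<phi>)" using ax by (rule derives.ax)
  hence "subst \<sigma> \<phi> \<in> fms M" by (rule derives_fm[OF _ wf_M]) simp
  thus ?case by (intro join_intro derives.ax ax assms(3))
next
  case (mp \<phi> \<psi>)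
  have "\<phi> \<^bold>\<rightarrow> \<psi> \<in> fms M" using derives_fm[OF mp(2) wf_M assms(2)] .
  hence "\<phi> \<in> fms M" "\<psi> \<in> fms M" by (simp_all add: fms_def)
  thus ?case by (rule join_mp[OF mp(3,4) _ _ assms(3)])
next
  case (rl P \<phi> \<sigma>)
  \<comment> \<open>the side formula of a rule for the consistency operator absorbs the new disjunct\<close>
  have circ: "derives M T ((subst \<sigma> y \<^bold>\<or> \<sigma> 2) \<^bold>\<or> \<delta>)"
    if r: "({x \<^bold>\<or> Var 2}, y \<^bold>\<or> Var 2) \<in> rules M" and P: "P = {x \<^bold>\<or> Var 2}"
      and sub: "\<And>\<tau>. (\<forall>n<2. \<tau> n = \<sigma> n) \<Longrightarrow> subst \<tau> x = subst \<sigma> x \<and> subst \<tau> y = subst \<sigma> y"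
      for x y
  proof -
    define \<tau> where "\<tau> = \<sigma>(2 := \<sigma> 2 \<^bold>\<or> \<delta>)"
    have rg: "range \<tau> \<subseteq> fms M" "\<sigma> 2 \<in> fms M" using rl(2) assms(3) by (auto simp: \<tau>_def fms_def)
    have xy: "subst \<sigma> x \<in> fms M" "subst \<sigma> y \<in> fms M"
      using subst_fm[OF _ rl(2)] wf_M r by (auto simp: well_formed_def fms_def)
    have t: "subst \<tau> x = subst \<sigma> x" "subst \<tau> y = subst \<sigma> y" using sub[of \<tau>] by (auto simp: \<tau>_def)
    have "derives M T ((subst \<sigma> x \<^bold>\<or> \<sigma> 2) \<^bold>\<or> \<delta>)" using rl(3) P by simp
    hence "derives M T (subst \<sigma> x \<^bold>\<or> (\<sigma> 2 \<^bold>\<or> \<delta>))" using join_assoc xy rg(2) assms(3) by blast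
    hence "derives M T (subst \<tau> (x \<^bold>\<or> Var 2))" by (simp add: t) (simp add: \<tau>_def)
    with derives.rl[OF r rg(1)] have "derives M T (subst \<tau> (y \<^bold>\<or> Var 2))" by blast
    hence "derives M T (subst \<sigma> y \<^bold>\<or> (\<sigma> 2 \<^bold>\<or> \<delta>))" by (simp add: t) (simp add: \<tau>_def)
    thus ?thesis using join_assoc xy rg(2) assms(3) by blast
  qed
  from rl(1) consider P' \<phi>' where "(P', \<phi>') \<in> rules L" "P = old ` P'" "\<phi> = old \<phi>'"
    | "P = {(Var 0 \<^bold>\<leftrightarrow> Var 1) \<^bold>\<or> Var 2}" "\<phi> = (\<^bold>\<circle> (Var 0) \<^bold>\<leftrightarrow> \<^bold>\<circle> (Var 1)) \<^bold>\<or> Var 2"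
    | "P = {(\<^bold>\<not> \<^bold>\<not> (Var 0) \<^bold>\<and> (Var 0 \<^bold>\<rightarrow> Var 1)) \<^bold>\<or> Var 2}"
      "\<phi> = (\<^bold>\<circle> (Var 0) \<^bold>\<rightarrow> \<^bold>\<circle> (Var 1)) \<^bold>\<or> Var 2"
    unfolding rules_min by auto
  thus ?case
  proof cases
    case 1
    thus ?thesis using old_rule_join[OF 1(1) rl(2) assms(3)] rl(3) by auto
  next
    case 2
    thus ?thesis using circ[of "Var 0 \<^bold>\<leftrightarrow> Var 1" "\<^bold>\<circle> (Var 0) \<^bold>\<leftrightarrow> \<^bold>\<circle> (Var 1)"] rl(1) by simp
  next
    case 3
    thus ?thesis
      using circ[of "\<^bold>\<not> \<^bold>\<not> (Var 0) \<^bold>\<and> (Var 0 \<^bold>\<rightarrow> Var 1)" "\<^bold>\<circle> (Var 0) \<^bold>\<rightarrow> \<^bold>\<circle> (Var 1)"] rl(1) by simp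
  qed
qed (use assms(4) in auto)

text \<open>From \<open>a \<or> b\<close>, the derivation of \<open>\<phi>\<close> from \<open>a\<close> yields \<open>\<phi> \<or> b\<close>; then the derivation of \<open>\<phi>\<close> from
  \<open>b\<close> yields \<open>\<phi> \<or> \<phi>\<close>.\<close>
lemma proof_by_cases:
  assumes "derives M T (a \<^bold>\<or> b)" "derives M (insert a T) \<phi>" "derives M (insert b T) \<phi>"
    and "a \<in> fms M" "b \<in> fms M" "T \<subseteq> fms M"
  shows "derives M T \<phi>"
proof -
  have \<phi>: "\<phi> \<in> fms M" using derives_fm[OF assms(2) wf_M] assms(4,6) by simp
  have T: "derives M T (\<gamma> \<^bold>\<or> \<delta>)" if "\<gamma> \<in> T" "\<delta> \<in> fms M" for \<gamma> \<delta>
    using that assms(6) by (intro join_intro derives.hyp) auto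
  have "derives M T (\<phi> \<^bold>\<or> b)"
    using assms T by (intro derives_join[OF assms(2)]) auto
  hence "derives M T (b \<^bold>\<or> \<phi>)" using \<phi> assms(5) by (rule join_comm)
  hence "derives M T (\<phi> \<^bold>\<or> \<phi>)"
    using assms \<phi> T by (intro derives_join[OF assms(3)]) auto
  thus ?thesis using \<phi> by (rule join_idem)
qed

text \<open>By Zorn's lemma there is a maximal extension that does not derive \<open>\<phi>\<close>. Adding a formula that it
  does not derive makes \<open>\<phi>\<close> derivable, so if it derived neither \<open>a\<close> nor \<open>b\<close> but \<open>a \<or> b\<close>, proof by
  cases would derive \<open>\<phi>\<close>.\<close>
lemma prime_extension:
  assumes "\<Gamma> \<subseteq> fms M" "\<not> derives M \<Gamma> \<phi>"
  obtains T where "\<Gamma> \<subseteq> T" "T \<subseteq> fms M" "\<not> derives M T \<phi>"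
    "\<And>a b. \<lbrakk>a \<in> fms M; b \<in> fms M; derives M T (a \<^bold>\<or> b)\<rbrakk> \<Longrightarrow> derives M T a \<or> derives M T b"
proof -
  define \<T> where "\<T> = {T. \<Gamma> \<subseteq> T \<and> T \<subseteq> fms M \<and> \<not> derives M T \<phi>}"
  have "\<exists>T\<in>\<T>. \<forall>X\<in>\<T>. T \<subseteq> X \<longrightarrow> X = T"
  proof (rule subset_Zorn_nonempty)
    show "\<T> \<noteq> {}" using assms by (auto simp: \<T>_def)
    fix \<C> assume C: "\<C> \<noteq> {}" "subset.chain \<T> \<C>"
    hence mem: "\<Gamma> \<subseteq> T \<and> T \<subseteq> fms M \<and> \<not> derives M T \<phi>" if "T \<in> \<C>" for T
      using that by (auto simp: subset_chain_def \<T>_def)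
    have "\<not> derives M (\<Union>\<C>) \<phi>"
    proof
      assume "derives M (\<Union>\<C>) \<phi>"
      then obtain \<Delta> where \<Delta>: "finite \<Delta>" "\<Delta> \<subseteq> \<Union>\<C>" "derives M \<Delta> \<phi>"
        using derives_compact wf_M by blast
      then obtain T where T: "T \<in> \<C>" "\<Delta> \<subseteq> T"
        using finite_subset_Union_chain C by metis
      have "derives M T \<phi>"
        by (rule derives_cut[OF \<Delta>(3)]) (use T in \<open>auto intro: derives.hyp\<close>)
      thus False using mem T(1) by blast
    qed
    moreover have "\<Gamma> \<subseteq> \<Union>\<C>" "\<Union>\<C> \<subseteq> fms M" using mem C(1) by blast+
    ultimately show "\<Union>\<C> \<in> \<T>" by (simp add: \<T>_def)
  qed
  then obtain T where T: "T \<in> \<T>" and max: "\<And>X. \<lbrakk>X \<in> \<T>; T \<subseteq> X\<rbrakk> \<Longrightarrow> X = T" by blast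
  have ext: "derives M (insert a T) \<phi>" if "a \<in> fms M" "\<not> derives M T a" for a
    using max[of "insert a T"] T that derives.hyp[of a T M] by (auto simp: \<T>_def)
  show thesis
  proof (rule that[of T])
    fix a b assume "a \<in> fms M" "b \<in> fms M" "derives M T (a \<^bold>\<or> b)"
    thus "derives M T a \<or> derives M T b"
      using ext[of a] ext[of b] proof_by_cases[of T a b \<phi>] T by (auto simp: \<T>_def)
  qed (use T in \<open>auto simp: \<T>_def\<close>)
qed

end

section \<open>The Lindenbaum chain of a prime theory\<close>

lemma circ_expand_simps [simp]:
  "carrier (circ_expand A f) = carrier A" "mult (circ_expand A f) = mult A"
  "one (circ_expand A f) = one A" "wedge (circ_expand A f) = wedge A"
  "vee (circ_expand A f) = vee A" "resid (circ_expand A f) = resid A"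
  "zero (circ_expand A f) = zero A"
  "conn (circ_expand A f) (Old c) xs = conn A c xs" "conn (circ_expand A f) Circ xs = f (hd xs)"
  by (simp_all add: circ_expand_def)

lemma eval_old: "eval (circ_expand A f) e (old a) = eval A e a"
  by (induction a) (auto simp: o_def cong: map_cong)

text \<open>The classes of formulas modulo provable equivalence are coded by elements of \<open>'b\<close>, so that the
  chain lives in the type over which completeness is stated.\<close>
locale lindenbaum = semilinear_core_expansion L ty
  for L :: "'c calculus" and ty :: "'a itself" +
  fixes T :: "'c circ_conn fm set" and q :: "'c circ_conn fm \<Rightarrow> 'b"
  assumes T_fms: "T \<subseteq> fms M"
    and prime: "\<lbrakk>a \<in> fms M; b \<in> fms M; derives M T (a \<^bold>\<or> b)\<rbrakk> \<Longrightarrow> derives M T a \<or> derives M T b"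
    and q_eq_iff: "\<lbrakk>a \<in> fms M; b \<in> fms M\<rbrakk> \<Longrightarrow>
       q a = q b \<longleftrightarrow> derives M T (a \<^bold>\<rightarrow> b) \<and> derives M T (b \<^bold>\<rightarrow> a)"
begin

definition rep :: "'b \<Rightarrow> 'c circ_conn fm" where
  "rep x = (SOME a. a \<in> fms M \<and> q a = x)"

definition lind :: "('b, 'c) alg" where
  "lind = \<lparr>carrier = q ` fms M, mult = (\<lambda>x y. q (rep x \<^bold>& rep y)), one = q \<^bold>\<top>,
     wedge = (\<lambda>x y. q (rep x \<^bold>\<and> rep y)), vee = (\<lambda>x y. q (rep x \<^bold>\<or> rep y)),
     resid = (\<lambda>x y. q (rep x \<^bold>\<rightarrow> rep y)), zero = q \<^bold>\<bottom>,
     conn = (\<lambda>c xs. q (Con (Old c) (map rep xs)))\<rparr>"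

definition circ_op :: "'b \<Rightarrow> 'b" where
  "circ_op x = q (\<^bold>\<circle> (rep x))"

lemma rep: "x \<in> carrier lind \<Longrightarrow> rep x \<in> fms M \<and> q (rep x) = x"
  unfolding rep_def by (rule someI_ex) (auto simp: lind_def)

lemma rep_q: "a \<in> fms M \<Longrightarrow> rep (q a) \<in> fms M \<and> q (rep (q a)) = q a"
  by (rule rep) (simp add: lind_def)

text \<open>All congruence properties of the base language follow at once from a single fact: \<open>t(p) \<rightarrow> t(r)\<close> is a
  consequence of \<open>{p\<^sub>n \<rightarrow> r\<^sub>n, r\<^sub>n \<rightarrow> p\<^sub>n | n}\<close>, since on a chain these hypotheses give corresponding variables
  equal values.\<close>
lemma old_congruence:
  assumes "t \<in> fms L" and "\<And>n. \<sigma> n \<in> fms M" "\<And>n. \<tau> n \<in> fms M" "\<And>n. q (\<sigma> n) = q (\<tau> n)"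
  shows "q (subst \<sigma> (old t)) = q (subst \<tau> (old t))"
proof -
  have imp: "derives M T (subst \<sigma> (old t) \<^bold>\<rightarrow> subst \<tau> (old t))"
    if "\<And>n. \<sigma> n \<in> fms M" "\<And>n. \<tau> n \<in> fms M" "\<And>n. q (\<sigma> n) = q (\<tau> n)" for \<sigma> \<tau>
  proof -
    \<comment> \<open>the two copies of the variables are interleaved\<close>
    define \<rho> where "\<rho> n = (if even n then \<sigma> (n div 2) else \<tau> (n div 2))" for n
    define ev where "ev = (subst (\<lambda>n. Var (2 * n)) :: 'c fm \<Rightarrow> 'c fm)"
    define od where "od = (subst (\<lambda>n. Var (2 * n + 1)) :: 'c fm \<Rightarrow> 'c fm)"
    have fm: "ev t \<in> fms L" "od t \<in> fms L"
      unfolding ev_def od_def by (rule subst_fm[OF assms(1)]; auto simp: fms_def)+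
    have sub: "subst \<rho> (old (ev t)) = subst \<sigma> (old t)" "subst \<rho> (old (od t)) = subst \<tau> (old t)"
      by (simp_all add: ev_def od_def map_fm_subst subst_subst \<rho>_def)
    define \<Gamma> where "\<Gamma> = (\<Union>n. {Var (2 * n) \<^bold>\<rightarrow> Var (2 * n + 1), Var (2 * n + 1) \<^bold>\<rightarrow> Var (2 * n)} :: 'c fm set)"
    have "derives M T (subst \<rho> (old (ev t \<^bold>\<rightarrow> od t)))"
    proof (rule chain_consequence[of \<Gamma>], goal_cases)
      case (1 A e)
      interpret mtl_chain A by fact
      have "e (2 * n) = e (2 * n + 1)" for n
        using 1(5)[of "Var (2 * n) \<^bold>\<rightarrow> Var (2 * n + 1)"] 1(5)[of "Var (2 * n + 1) \<^bold>\<rightarrow> Var (2 * n)"] 1(4)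
        by (intro le_antisym) (auto simp: \<Gamma>_def)
      hence "eval A e (ev t) = eval A e (od t)" by (simp add: ev_def od_def eval_subst)
      moreover have "eval A e (od t) \<in> carrier A"
        using 1(1,3) fm(2) by (intro eval_closed) (auto simp: L_chain_def)
      ultimately show ?case by simp
    next
      case (5 \<gamma>)
      thus ?case using q_eq_iff that by (auto simp: \<Gamma>_def \<rho>_def)
    qed (use fm that in \<open>auto simp: \<Gamma>_def \<rho>_def fms_def\<close>)
    thus ?thesis by (simp add: sub)
  qed
  have "subst \<sigma> (old t) \<in> fms M" "subst \<tau> (old t) \<in> fms M"
    by (rule subst_fm; use assms in \<open>auto simp: fms_def old_fm\<close>)+
  thus ?thesis using imp[of \<sigma> \<tau>] imp[of \<tau> \<sigma>] assms q_eq_iff by simp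
qed

lemma inst_congruence:
  assumes "t \<in> fms L" "set as \<subseteq> fms M"
  shows "q (subst (inst (map (rep \<circ> q) as)) (old t)) = q (subst (inst as) (old t))"
proof (rule old_congruence[OF assms(1)])
  fix n
  have a: "as ! n \<in> fms M" if "n < length as" using that assms(2) nth_mem by blast
  show "inst as n \<in> fms M" using a by (auto simp: inst_def fms_def)
  show "inst (map (rep \<circ> q) as) n \<in> fms M" using a rep_q by (auto simp: inst_def) (auto simp: fms_def)
  show "q (inst (map (rep \<circ> q) as) n) = q (inst as n)" using a rep_q by (auto simp: inst_def)
qed

lemma lind_ops:
  assumes "a \<in> fms M" "b \<in> fms M"
  shows "q a \<otimes>\<^bsub>lind\<^esub> q b = q (a \<^bold>& b)" "q a \<curlywedge>\<^bsub>lind\<^esub> q b = q (a \<^bold>\<and> b)"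
    "q a \<leadsto>\<^bsub>lind\<^esub> q b = q (a \<^bold>\<rightarrow> b)" "q a \<curlyvee>\<^bsub>lind\<^esub> q b = q (a \<^bold>\<or> b)"
  using assms inst_congruence[of "Var 0 \<^bold>& Var 1" "[a, b]"] inst_congruence[of "Var 0 \<^bold>\<and> Var 1" "[a, b]"]
    inst_congruence[of "Var 0 \<^bold>\<rightarrow> Var 1" "[a, b]"] inst_congruence[of "Var 0 \<^bold>\<or> Var 1" "[a, b]"]
  by (simp_all add: lind_def inst_def fms_def)

lemma subst_inst_vars: "map (\<lambda>n. subst (inst as) (old (Var n))) [0..<length as] = as"
  by (rule nth_equalityI) (auto simp: inst_def)

lemma lind_conn:
  assumes "c \<in> conns L" "length as = arity L c" "set as \<subseteq> fms M"
  shows "conn lind c (map q as) = q (Con (Old c) as)"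
proof -
  have t: "Con c (map Var [0..<length as]) \<in> fms L"
    using assms by (simp add: fms_def list_all_iff)
  show ?thesis
    using inst_congruence[OF t assms(3)] subst_inst_vars[of as] subst_inst_vars[of "map (rep \<circ> q) as"]
    by (simp add: lind_def o_def)
qed

lemma derives_top_iff: "a \<in> fms M \<Longrightarrow> q a = q \<^bold>\<top> \<longleftrightarrow> derives M T a"
proof -
  assume a: "a \<in> fms M"
  have "derives M T (subst (inst [a]) (old (Var 0 \<^bold>\<rightarrow> \<^bold>\<top>)))"
    by (rule mtl_consequence[of "{}"])
      (use a in \<open>auto simp: inst_def fms_def chain_simps\<close>)
  moreover have "derives M T (subst (inst [a]) (old (\<^bold>\<top> \<^bold>\<rightarrow> Var 0)))" if "derives M T a"
    by (rule mtl_consequence[of "{Var 0}"])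
      (use a that in \<open>auto simp: inst_def fms_def chain_simps\<close>)
  moreover have "derives M T (subst (inst [a]) (old (Var 0)))" if "derives M T (\<^bold>\<top> \<^bold>\<rightarrow> a)"
    by (rule mtl_consequence[of "{\<^bold>\<top> \<^bold>\<rightarrow> Var 0}"])
      (use a that in \<open>auto simp: inst_def fms_def chain_simps\<close>)
  moreover have "\<^bold>\<top> \<in> fms M" by (simp add: fms_def)
  ultimately show ?thesis using q_eq_iff[OF a, of "\<^bold>\<top>"] by (auto simp: inst_def)
qed

lemma lind_one_iff: "a \<in> fms M \<Longrightarrow> q a = \<one>\<^bsub>lind\<^esub> \<longleftrightarrow> derives M T a"
  using derives_top_iff by (simp add: lind_def)

lemma circ_congruence:
  assumes "a \<in> fms M" "b \<in> fms M" "q a = q b"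
  shows "q (\<^bold>\<circle> a) = q (\<^bold>\<circle> b)"
proof -
  have imp: "derives M T (\<^bold>\<circle> a \<^bold>\<rightarrow> \<^bold>\<circle> b)" if "a \<in> fms M" "b \<in> fms M" "q a = q b" for a b
  proof -
    \<comment> \<open>the side formula is the formula to be derived, and is absorbed in the end\<close>
    let ?\<delta> = "\<^bold>\<circle> a \<^bold>\<rightarrow> \<^bold>\<circle> b"
    have \<delta>: "?\<delta> \<in> fms M" using that by (simp add: fms_def)
    have "derives M T (subst (inst [a, b, ?\<delta>]) (old ((Var 0 \<^bold>\<leftrightarrow> Var 1) \<^bold>\<or> Var 2)))"
      by (rule mtl_consequence[of "{Var 0 \<^bold>\<rightarrow> Var 1, Var 1 \<^bold>\<rightarrow> Var 0}"])
        (use that q_eq_iff in \<open>auto simp: inst_def fms_def chain_simps\<close>)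
    hence "derives M T (subst (inst [a, b, ?\<delta>]) ((Var 0 \<^bold>\<leftrightarrow> Var 1) \<^bold>\<or> Var 2))"
      by (simp add: inst_def)
    moreover have "({(Var 0 \<^bold>\<leftrightarrow> Var 1) \<^bold>\<or> Var 2}, (\<^bold>\<circle> (Var 0) \<^bold>\<leftrightarrow> \<^bold>\<circle> (Var 1)) \<^bold>\<or> Var 2) \<in> rules M"
      unfolding rules_min by blast
    moreover have "range (inst [a, b, ?\<delta>]) \<subseteq> fms M" using that \<delta> by (intro range_inst) auto
    ultimately have "derives M T (subst (inst [a, b, ?\<delta>]) ((\<^bold>\<circle> (Var 0) \<^bold>\<leftrightarrow> \<^bold>\<circle> (Var 1)) \<^bold>\<or> Var 2))"
      by (intro derives.rl) auto
    hence c: "derives M T ((\<^bold>\<circle> a \<^bold>\<leftrightarrow> \<^bold>\<circle> b) \<^bold>\<or> ?\<delta>)" by (simp add: inst_def)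
    have "derives M T (subst (inst [\<^bold>\<circle> a, \<^bold>\<circle> b]) (old (Var 0 \<^bold>\<rightarrow> Var 1)))"
      by (rule mtl_consequence[of "{(Var 0 \<^bold>\<leftrightarrow> Var 1) \<^bold>\<or> (Var 0 \<^bold>\<rightarrow> Var 1)}"])
        (use c that in \<open>auto simp: inst_def fms_def chain_simps\<close>)
    thus ?thesis by (simp add: inst_def)
  qed
  have "\<^bold>\<circle> a \<in> fms M" "\<^bold>\<circle> b \<in> fms M" using assms by (auto simp: fms_def)
  thus ?thesis using imp[of a b] imp[of b a] assms q_eq_iff by simp
qed

lemma circ_op_q: "a \<in> fms M \<Longrightarrow> circ_op (q a) = q (\<^bold>\<circle> a)"
  unfolding circ_op_def using rep_q circ_congruence by metis

text \<open>The truth lemma. By the congruence properties the operations do not depend on the representatives.\<close>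
lemma eval_lind:
  assumes "range \<sigma> \<subseteq> fms M" "a \<in> fms M"
  shows "eval (circ_expand lind circ_op) (\<lambda>n. q (\<sigma> n)) a = q (subst \<sigma> a)"
proof -
  have sfm: "subst \<sigma> a \<in> fms M" if "a \<in> fms M" for a
    using subst_fm[OF that assms(1)] .
  show ?thesis using assms(2)
  proof (induction a)
    case (Var n)
    show ?case by simp
  next
    case Bot
    thus ?case by (simp add: lind_def)
  next
    case (Con c as)
    have fm: "a \<in> fms M" if "a \<in> set as" for a using Con.prems that by (auto simp: fms_def list_all_iff)
    have ev: "map (eval (circ_expand lind circ_op) (\<lambda>n. q (\<sigma> n))) as = map q (map (subst \<sigma>) as)"
      using Con.IH fm by simp
    show ?case
    proof (cases c)
      case (Old c')
      hence "c' \<in> conns L" "length as = arity L c'" using Con.prems by (auto simp: fms_def)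
      hence "conn lind c' (map q (map (subst \<sigma>) as)) =
          q (Con (Old c') (map (subst \<sigma>) as))"
        using sfm fm by (intro lind_conn) auto
      thus ?thesis unfolding Old eval.simps circ_expand_simps ev subst.simps .
    next
      case Circ
      hence "length as = 1" using Con.prems by (auto simp: fms_def)
      then obtain a where a: "as = [a]" by (auto simp: length_Suc_conv)
      thus ?thesis using circ_op_q[OF sfm[OF fm]] ev Circ by simp
    qed
  next
    case (Meet a b)
    thus ?case using sfm[of a] sfm[of b] lind_ops by (auto simp: fms_def)
  next
    case (Fus a b)
    thus ?case using sfm[of a] sfm[of b] lind_ops by (auto simp: fms_def)
  next
    case (Imp a b)
    thus ?case using sfm[of a] sfm[of b] lind_ops by (auto simp: fms_def)
  qed
qed

lemma eval_lind_old:
  assumes "e \<in> evaluations lind" "a \<in> fms L"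
  shows "eval lind e a = q (subst (\<lambda>n. rep (e n)) (old a))"
proof -
  have "old a \<in> fms M" using assms(2) by (simp add: fms_def old_fm)
  moreover have "range (\<lambda>n. rep (e n)) \<subseteq> fms M" "(\<lambda>n. q (rep (e n))) = e"
    using assms(1) rep by (auto simp: evaluations_def image_subset_iff)
  ultimately show ?thesis using eval_lind[of "\<lambda>n. rep (e n)" "old a"] eval_old[of lind circ_op e a] by simp
qed

definition vals :: "'b list \<Rightarrow> nat \<Rightarrow> 'b" where
  "vals xs n = (if n < length xs then xs ! n else \<one>\<^bsub>lind\<^esub>)"

text \<open>An identity of MTL-chains holds in the Lindenbaum algebra, since both implications between its
  sides are derivable. The laws of MTL-algebras are obtained in this way.\<close>
lemma lind_law:
  assumes "\<And>(A :: ('a, 'c) alg) e. \<lbrakk>mtl_chain A; \<And>n. e n \<in> carrier A\<rbrakk> \<Longrightarrow> eval A e s = eval A e t"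
    and "s \<in> fms L" "t \<in> fms L" "set xs \<subseteq> carrier lind"
  shows "eval lind (vals xs) s = eval lind (vals xs) t"
proof -
  have ev: "vals xs \<in> evaluations lind"
    using assms(4) nth_mem by (fastforce simp: evaluations_def vals_def lind_def fms_def)
  hence rg: "range (\<lambda>n. rep (vals xs n)) \<subseteq> fms M"
    using rep by (auto simp: evaluations_def image_subset_iff)
  have imp: "derives M T (subst (\<lambda>n. rep (vals xs n)) (old (s \<^bold>\<rightarrow> t)))"
    if "\<And>(A :: ('a, 'c) alg) e. \<lbrakk>mtl_chain A; \<And>n. e n \<in> carrier A\<rbrakk> \<Longrightarrow> eval A e s = eval A e t"
      "s \<in> fms L" "t \<in> fms L" for s t
  proof (rule chain_consequence[of "{}", OF _ _ _ rg], goal_cases)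
    case (1 A e)
    interpret mtl_chain A by fact
    have "eval A e t \<in> carrier A" using 1 that by (intro eval_closed) (auto simp: L_chain_def)
    thus ?case using 1 that(1)[of A e] by simp
  qed (use that in \<open>auto simp: fms_def\<close>)
  have "subst (\<lambda>n. rep (vals xs n)) (old r) \<in> fms M" if "r \<in> fms L" for r
    using that rg by (intro subst_fm) (auto simp: fms_def old_fm)
  thus ?thesis
    using imp[of s t] imp[of t s] assms q_eq_iff by (simp add: eval_lind_old[OF ev])
qed

lemma lind_closed:
  "\<lbrakk>x \<in> carrier lind; y \<in> carrier lind\<rbrakk> \<Longrightarrow> x \<otimes>\<^bsub>lind\<^esub> y \<in> carrier lind"
  "\<lbrakk>x \<in> carrier lind; y \<in> carrier lind\<rbrakk> \<Longrightarrow> x \<curlywedge>\<^bsub>lind\<^esub> y \<in> carrier lind"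
  "\<lbrakk>x \<in> carrier lind; y \<in> carrier lind\<rbrakk> \<Longrightarrow> x \<curlyvee>\<^bsub>lind\<^esub> y \<in> carrier lind"
  "\<lbrakk>x \<in> carrier lind; y \<in> carrier lind\<rbrakk> \<Longrightarrow> x \<leadsto>\<^bsub>lind\<^esub> y \<in> carrier lind"
  "\<one>\<^bsub>lind\<^esub> \<in> carrier lind" "\<zero>\<^bsub>lind\<^esub> \<in> carrier lind"
  "x \<in> carrier lind \<Longrightarrow> circ_op x \<in> carrier lind"
  using rep[of x] rep[of y] by (auto simp: lind_def circ_op_def fms_def)

lemma lind_vee:
  assumes "x \<in> carrier lind" "y \<in> carrier lind"
  shows "((x \<leadsto>\<^bsub>lind\<^esub> y) \<leadsto>\<^bsub>lind\<^esub> y) \<curlywedge>\<^bsub>lind\<^esub> ((y \<leadsto>\<^bsub>lind\<^esub> x) \<leadsto>\<^bsub>lind\<^esub> x) = x \<curlyvee>\<^bsub>lind\<^esub> y"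
proof -
  from assms obtain a b where "a \<in> fms M" "b \<in> fms M" "x = q a" "y = q b"
    by (auto simp: lind_def)
  thus ?thesis by (simp add: lind_ops fms_def)
qed

lemma lind_le_iff:
  assumes "a \<in> fms M" "b \<in> fms M"
  shows "q a \<preceq>\<^bsub>lind\<^esub> q b \<longleftrightarrow> derives M T (a \<^bold>\<rightarrow> b)"
proof -
  have "derives M T (subst (inst [a, b]) (old (Var 0 \<^bold>\<and> Var 1 \<^bold>\<rightarrow> Var 0)))"
    by (rule mtl_consequence[of "{}"])
      (use assms in \<open>auto simp: inst_def fms_def chain_simps mtl_chain.wedge_le\<close>)
  moreover have "derives M T (subst (inst [a, b]) (old (Var 0 \<^bold>\<rightarrow> Var 0 \<^bold>\<and> Var 1)))"
    if "derives M T (a \<^bold>\<rightarrow> b)"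
    by (rule mtl_consequence[of "{Var 0 \<^bold>\<rightarrow> Var 1}"])
      (use assms that in \<open>auto simp: inst_def fms_def chain_simps mtl_chain.le_wedge_iff\<close>)
  moreover have "derives M T (subst (inst [a, b]) (old (Var 0 \<^bold>\<rightarrow> Var 1)))"
    if "derives M T (a \<^bold>\<rightarrow> a \<^bold>\<and> b)"
    by (rule mtl_consequence[of "{Var 0 \<^bold>\<rightarrow> Var 0 \<^bold>\<and> Var 1}"])
      (use assms that in \<open>auto simp: inst_def fms_def chain_simps mtl_chain.le_wedge_iff\<close>)
  moreover have "a \<^bold>\<and> b \<in> fms M" using assms by (simp add: fms_def)
  ultimately show ?thesis
    using q_eq_iff[of "a \<^bold>\<and> b" a] assms by (auto simp: alg_le_def lind_ops inst_def)
qed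

lemma lind_resid_one_iff:
  assumes "x \<in> carrier lind" "y \<in> carrier lind"
  shows "x \<leadsto>\<^bsub>lind\<^esub> y = \<one>\<^bsub>lind\<^esub> \<longleftrightarrow> x \<preceq>\<^bsub>lind\<^esub> y"
proof -
  from assms obtain a b where "a \<in> fms M" "b \<in> fms M" "x = q a" "y = q b"
    by (auto simp: lind_def)
  thus ?thesis using lind_le_iff[of a b] lind_one_iff[of "a \<^bold>\<rightarrow> b"]
    by (simp add: lind_ops fms_def)
qed

text \<open>Prelinearity derives \<open>(a \<rightarrow> b) \<or> (b \<rightarrow> a)\<close>, and primeness selects a disjunct.\<close>
lemma lind_total:
  assumes "x \<in> carrier lind" "y \<in> carrier lind"
  shows "x \<preceq>\<^bsub>lind\<^esub> y \<or> y \<preceq>\<^bsub>lind\<^esub> x"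
proof -
  from assms obtain a b where ab: "a \<in> fms M" "b \<in> fms M" "x = q a" "y = q b"
    by (auto simp: lind_def)
  have "derives M T (subst (inst [a, b]) (old ((Var 0 \<^bold>\<rightarrow> Var 1) \<^bold>\<or> (Var 1 \<^bold>\<rightarrow> Var 0))))"
    by (rule mtl_consequence[of "{}"])
      (use ab in \<open>auto simp: inst_def fms_def chain_simps dest: mtl_chain.total\<close>)
  hence "derives M T (a \<^bold>\<rightarrow> b) \<or> derives M T (b \<^bold>\<rightarrow> a)"
    using ab by (intro prime) (auto simp: inst_def fms_def)
  thus ?thesis using ab lind_le_iff by auto
qed

lemma lind_top: "\<zero>\<^bsub>lind\<^esub> \<leadsto>\<^bsub>lind\<^esub> \<zero>\<^bsub>lind\<^esub> = \<one>\<^bsub>lind\<^esub>"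
  using lind_ops(3)[of "\<^bold>\<bottom>" "\<^bold>\<bottom>"] by (simp add: lind_def fms_def)

lemma lind_mtl_chain: "mtl_chain lind"
proof -
  let ?x = "Var 0 :: 'c fm" and ?y = "Var 1 :: 'c fm" and ?z = "Var 2 :: 'c fm"
  note law_simps = vals_def fms_def chain_simps lind_top lind_vee lind_closed
  have assoc: "x \<otimes>\<^bsub>lind\<^esub> y \<otimes>\<^bsub>lind\<^esub> z = x \<otimes>\<^bsub>lind\<^esub> (y \<otimes>\<^bsub>lind\<^esub> z)"
     "(x \<curlywedge>\<^bsub>lind\<^esub> y) \<curlywedge>\<^bsub>lind\<^esub> z = x \<curlywedge>\<^bsub>lind\<^esub> (y \<curlywedge>\<^bsub>lind\<^esub> z)"
     "(x \<curlyvee>\<^bsub>lind\<^esub> y) \<curlyvee>\<^bsub>lind\<^esub> z = x \<curlyvee>\<^bsub>lind\<^esub> (y \<curlyvee>\<^bsub>lind\<^esub> z)"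
     "x \<otimes>\<^bsub>lind\<^esub> y \<leadsto>\<^bsub>lind\<^esub> z = x \<leadsto>\<^bsub>lind\<^esub> (y \<leadsto>\<^bsub>lind\<^esub> z)"
    if "x \<in> carrier lind" "y \<in> carrier lind" "z \<in> carrier lind" for x y z
    using that lind_law[of "(?x \<^bold>& ?y) \<^bold>& ?z" "?x \<^bold>& (?y \<^bold>& ?z)" "[x, y, z]"]
      lind_law[of "(?x \<^bold>\<and> ?y) \<^bold>\<and> ?z" "?x \<^bold>\<and> (?y \<^bold>\<and> ?z)" "[x, y, z]"]
      lind_law[of "(?x \<^bold>\<or> ?y) \<^bold>\<or> ?z" "?x \<^bold>\<or> (?y \<^bold>\<or> ?z)" "[x, y, z]"]
      lind_law[of "(?x \<^bold>& ?y) \<^bold>\<rightarrow> ?z" "?x \<^bold>\<rightarrow> (?y \<^bold>\<rightarrow> ?z)" "[x, y, z]"]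
    by (simp_all add: law_simps mtl_chain.laws(1,6,7) mtl_chain.resid_curry)
  have comm: "x \<otimes>\<^bsub>lind\<^esub> y = y \<otimes>\<^bsub>lind\<^esub> x" "x \<curlywedge>\<^bsub>lind\<^esub> y = y \<curlywedge>\<^bsub>lind\<^esub> x" "x \<curlyvee>\<^bsub>lind\<^esub> y = y \<curlyvee>\<^bsub>lind\<^esub> x"
     "x \<curlywedge>\<^bsub>lind\<^esub> (x \<curlyvee>\<^bsub>lind\<^esub> y) = x" "x \<curlyvee>\<^bsub>lind\<^esub> (x \<curlywedge>\<^bsub>lind\<^esub> y) = x"
     "(x \<leadsto>\<^bsub>lind\<^esub> y) \<curlyvee>\<^bsub>lind\<^esub> (y \<leadsto>\<^bsub>lind\<^esub> x) = \<one>\<^bsub>lind\<^esub>"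
    if "x \<in> carrier lind" "y \<in> carrier lind" for x y
    using that lind_law[of "?x \<^bold>& ?y" "?y \<^bold>& ?x" "[x, y]"]
      lind_law[of "?x \<^bold>\<and> ?y" "?y \<^bold>\<and> ?x" "[x, y]"]
      lind_law[of "?x \<^bold>\<or> ?y" "?y \<^bold>\<or> ?x" "[x, y]"]
      lind_law[of "?x \<^bold>\<and> (?x \<^bold>\<or> ?y)" "?x" "[x, y]"]
      lind_law[of "?x \<^bold>\<or> (?x \<^bold>\<and> ?y)" "?x" "[x, y]"]
      lind_law[of "(?x \<^bold>\<rightarrow> ?y) \<^bold>\<or> (?y \<^bold>\<rightarrow> ?x)" "\<^bold>\<top>" "[x, y]"]
    by (simp_all add: law_simps mtl_chain.laws(2-5,8-))
  have unit: "\<one>\<^bsub>lind\<^esub> \<otimes>\<^bsub>lind\<^esub> x = x"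
     "\<zero>\<^bsub>lind\<^esub> \<leadsto>\<^bsub>lind\<^esub> x = \<one>\<^bsub>lind\<^esub>" "x \<leadsto>\<^bsub>lind\<^esub> \<one>\<^bsub>lind\<^esub> = \<one>\<^bsub>lind\<^esub>"
    if "x \<in> carrier lind" for x
    using that lind_law[of "\<^bold>\<top> \<^bold>& ?x" "?x" "[x]"] lind_law[of "\<^bold>\<bottom> \<^bold>\<rightarrow> ?x" "\<^bold>\<top>" "[x]"]
      lind_law[of "?x \<^bold>\<rightarrow> \<^bold>\<top>" "\<^bold>\<top>" "[x]"]
    by (simp_all add: law_simps mtl_chain.laws(3))
  have order: "\<zero>\<^bsub>lind\<^esub> \<preceq>\<^bsub>lind\<^esub> x" "x \<preceq>\<^bsub>lind\<^esub> \<one>\<^bsub>lind\<^esub>" if "x \<in> carrier lind" for x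
    using unit that lind_resid_one_iff lind_closed(5,6) by blast+
  have resid: "x \<otimes>\<^bsub>lind\<^esub> y \<preceq>\<^bsub>lind\<^esub> z \<longleftrightarrow> x \<preceq>\<^bsub>lind\<^esub> y \<leadsto>\<^bsub>lind\<^esub> z"
    if "x \<in> carrier lind" "y \<in> carrier lind" "z \<in> carrier lind" for x y z
    using lind_resid_one_iff assoc(4) lind_closed that by metis
  have runit: "x \<otimes>\<^bsub>lind\<^esub> \<one>\<^bsub>lind\<^esub> = x" if "x \<in> carrier lind" for x
    using unit(1) comm(1) lind_closed(5) that by metis
  show ?thesis
    by unfold_locales
      (assumption | rule lind_closed assoc(1-3) comm unit runit order resid lind_total)+
qed

lemma lind_L_chain: "L_chain L lind"
  unfolding L_chain_def L_algebra_def
proof (intro conjI ballI allI impI)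
  show "mtl_algebra lind" using lind_mtl_chain by (simp add: mtl_chain_def)
next
  fix c xs assume "c \<in> conns L" "length xs = arity L c \<and> set xs \<subseteq> carrier lind"
  thus "conn lind c xs \<in> carrier lind"
    using rep by (force simp: lind_def fms_def list_all_iff)
next
  fix e :: "nat \<Rightarrow> 'b" and \<phi> assume e: "e \<in> evaluations lind" and \<phi>: "\<phi> \<in> axs L"
  have "range (\<lambda>n. rep (e n)) \<subseteq> fms M"
    using e rep by (auto simp: evaluations_def image_subset_iff)
  hence "derives M T (subst (\<lambda>n. rep (e n)) (old \<phi>))"
    using \<phi> by (intro derives.ax) (auto simp: axs_min)
  moreover from this have "subst (\<lambda>n. rep (e n)) (old \<phi>) \<in> fms M"
    using derives_fm wf_M T_fms by blast
  moreover have "\<phi> \<in> fms L" using core \<phi> by (auto simp: core_expansion_def)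
  ultimately show "eval lind e \<phi> = \<one>\<^bsub>lind\<^esub>"
    using eval_lind_old[OF e] lind_one_iff by simp
next
  fix e :: "nat \<Rightarrow> 'b" and r assume e: "e \<in> evaluations lind" and r: "r \<in> rules L"
  obtain P \<phi> where P: "r = (P, \<phi>)" by fastforce
  have fm: "P \<subseteq> fms L" "\<phi> \<in> fms L" using core r P by (auto simp: core_expansion_def)
  have rg: "range (\<lambda>n. rep (e n)) \<subseteq> fms M"
    using e rep by (auto simp: evaluations_def image_subset_iff)
  have one: "eval lind e p = \<one>\<^bsub>lind\<^esub> \<longleftrightarrow> derives M T (subst (\<lambda>n. rep (e n)) (old p))" if "p \<in> fms L" for p
  proof -
    have "subst (\<lambda>n. rep (e n)) (old p) \<in> fms M"
      using that rg by (intro subst_fm) (auto simp: fms_def old_fm)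
    thus ?thesis using eval_lind_old[OF e that] lind_one_iff by simp
  qed
  have "eval lind e \<phi> = \<one>\<^bsub>lind\<^esub>" if "\<forall>p\<in>P. eval lind e p = \<one>\<^bsub>lind\<^esub>"
  proof -
    have "(old ` P, old \<phi>) \<in> rules M" using r P by (force simp: rules_min)
    moreover have "\<forall>p\<in>old ` P. derives M T (subst (\<lambda>n. rep (e n)) p)"
      using that one fm(1) by blast
    ultimately have "derives M T (subst (\<lambda>n. rep (e n)) (old \<phi>))"
      using rg by (intro derives.rl)
    thus ?thesis using one fm(2) by blast
  qed
  thus "case r of (P, \<phi>) \<Rightarrow> (\<forall>\<psi>\<in>P. eval lind e \<psi> = \<one>\<^bsub>lind\<^esub>) \<longrightarrow> eval lind e \<phi> = \<one>\<^bsub>lind\<^esub>"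
    by (simp add: P)
qed (use lind_total in blast)

lemma lind_circ_min_chain: "L_circ_min_chain L lind circ_op"
proof -
  interpret lind: mtl_chain lind by (rule lind_mtl_chain)
  have ax: "derives M T (subst (inst as) \<phi>)" if "\<phi> \<in> axs M" "set as \<subseteq> fms M" for \<phi> as
    using that(1) range_inst[OF that(2)] by (intro derives.ax) auto
  have one: "circ_op \<one>\<^bsub>lind\<^esub> = \<one>\<^bsub>lind\<^esub>"
  proof -
    have "derives M T (\<^bold>\<circle> \<^bold>\<top>)" using ax[of "\<^bold>\<circle> \<^bold>\<top>" "[]"] by (simp add: axs_min)
    hence "q (\<^bold>\<circle> \<^bold>\<top>) = \<one>\<^bsub>lind\<^esub>" by (subst lind_one_iff) (auto simp: fms_def)
    thus ?thesis using circ_op_q[of "\<^bold>\<top>"] by (simp add: lind_def fms_def)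
  qed
  have zero: "circ_op \<zero>\<^bsub>lind\<^esub> = \<one>\<^bsub>lind\<^esub>"
  proof -
    have "derives M T (\<^bold>\<circle> \<^bold>\<bottom>)" using ax[of "\<^bold>\<circle> \<^bold>\<bottom>" "[]"] by (simp add: axs_min)
    hence "q (\<^bold>\<circle> \<^bold>\<bottom>) = \<one>\<^bsub>lind\<^esub>" by (subst lind_one_iff) (auto simp: fms_def)
    thus ?thesis using circ_op_q[of "\<^bold>\<bottom>"] by (simp add: lind_def fms_def)
  qed
  have zero_q: "\<zero>\<^bsub>lind\<^esub> = q \<^bold>\<bottom>" by (simp add: lind_def)
  have ops: "x \<curlywedge>\<^bsub>lind\<^esub> \<sim>\<^bsub>lind\<^esub> x \<curlywedge>\<^bsub>lind\<^esub> circ_op x = \<zero>\<^bsub>lind\<^esub>"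
    "x \<curlyvee>\<^bsub>lind\<^esub> \<sim>\<^bsub>lind\<^esub> x \<curlyvee>\<^bsub>lind\<^esub> \<sim>\<^bsub>lind\<^esub> circ_op x = \<one>\<^bsub>lind\<^esub>" if "x \<in> carrier lind" for x
  proof -
    from that obtain a where a: "a \<in> fms M" "x = q a" by (auto simp: lind_def)
    have "derives M T (\<^bold>\<not> (a \<^bold>\<and> \<^bold>\<not> a \<^bold>\<and> \<^bold>\<circle> a))"
      using ax[of "\<^bold>\<not> (Var 0 \<^bold>\<and> \<^bold>\<not> Var 0 \<^bold>\<and> \<^bold>\<circle> (Var 0))" "[a]"] a
      by (simp add: axs_min inst_def)
    hence "q (a \<^bold>\<and> \<^bold>\<not> a \<^bold>\<and> \<^bold>\<circle> a) \<preceq>\<^bsub>lind\<^esub> q \<^bold>\<bottom>"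
      using a by (subst lind_le_iff) (auto simp: fms_def)
    hence "q (a \<^bold>\<and> \<^bold>\<not> a \<^bold>\<and> \<^bold>\<circle> a) = \<zero>\<^bsub>lind\<^esub>"
      using a lind.le_zero_iff by (simp add: lind_def fms_def)
    hence "q a \<curlywedge>\<^bsub>lind\<^esub> (\<sim>\<^bsub>lind\<^esub> q a \<curlywedge>\<^bsub>lind\<^esub> circ_op (q a)) = \<zero>\<^bsub>lind\<^esub>"
      using a by (simp add: circ_op_q zero_q lind_ops fms_def)
    thus "x \<curlywedge>\<^bsub>lind\<^esub> \<sim>\<^bsub>lind\<^esub> x \<curlywedge>\<^bsub>lind\<^esub> circ_op x = \<zero>\<^bsub>lind\<^esub>"
      using that lind_closed a(2) by (simp add: lind.wedge_assoc)
    have "derives M T (a \<^bold>\<or> \<^bold>\<not> a \<^bold>\<or> \<^bold>\<not> \<^bold>\<circle> a)"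
      using ax[of "Var 0 \<^bold>\<or> \<^bold>\<not> Var 0 \<^bold>\<or> \<^bold>\<not> \<^bold>\<circle> (Var 0)" "[a]"] a
      by (simp add: axs_min inst_def)
    hence "q (a \<^bold>\<or> \<^bold>\<not> a \<^bold>\<or> \<^bold>\<not> \<^bold>\<circle> a) = \<one>\<^bsub>lind\<^esub>"
      using a by (subst lind_one_iff) (auto simp: fms_def)
    moreover have "q (a \<^bold>\<or> \<^bold>\<not> a \<^bold>\<or> \<^bold>\<not> \<^bold>\<circle> a) = q a \<curlyvee>\<^bsub>lind\<^esub> (\<sim>\<^bsub>lind\<^esub> q a \<curlyvee>\<^bsub>lind\<^esub> \<sim>\<^bsub>lind\<^esub> circ_op (q a))"
      using a by (simp add: circ_op_q zero_q lind_ops fms_def)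
    ultimately have "q a \<curlyvee>\<^bsub>lind\<^esub> (\<sim>\<^bsub>lind\<^esub> q a \<curlyvee>\<^bsub>lind\<^esub> \<sim>\<^bsub>lind\<^esub> circ_op (q a)) = \<one>\<^bsub>lind\<^esub>" by simp
    thus "x \<curlyvee>\<^bsub>lind\<^esub> \<sim>\<^bsub>lind\<^esub> x \<curlyvee>\<^bsub>lind\<^esub> \<sim>\<^bsub>lind\<^esub> circ_op x = \<one>\<^bsub>lind\<^esub>"
      using that lind_closed a(2) by (simp add: lind.vee_assoc)
  qed
  have coh: "(circ_op x \<leadsto>\<^bsub>lind\<^esub> circ_op y) \<curlyvee>\<^bsub>lind\<^esub> z = \<one>\<^bsub>lind\<^esub>"
    if xyz: "x \<in> carrier lind" "y \<in> carrier lind" "z \<in> carrier lind"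
      and pr: "(\<sim>\<^bsub>lind\<^esub> \<sim>\<^bsub>lind\<^esub> x \<curlywedge>\<^bsub>lind\<^esub> (x \<leadsto>\<^bsub>lind\<^esub> y)) \<curlyvee>\<^bsub>lind\<^esub> z = \<one>\<^bsub>lind\<^esub>" for x y z
  proof -
    from xyz obtain a b c where abc: "a \<in> fms M" "b \<in> fms M" "c \<in> fms M" "x = q a" "y = q b" "z = q c"
      by (auto simp: lind_def)
    let ?P = "(\<^bold>\<not> \<^bold>\<not> (Var 0) \<^bold>\<and> (Var 0 \<^bold>\<rightarrow> Var 1)) \<^bold>\<or> Var 2"
    let ?C = "(\<^bold>\<circle> (Var 0) \<^bold>\<rightarrow> \<^bold>\<circle> (Var 1)) \<^bold>\<or> Var 2"
    have rg: "range (inst [a, b, c]) \<subseteq> fms M" using abc by (intro range_inst) auto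
    have fm': "subst (inst [a, b, c]) ?P \<in> fms M" "subst (inst [a, b, c]) ?C \<in> fms M"
      using rg by (intro subst_fm; simp add: fms_def)+
    have "(\<sim>\<^bsub>lind\<^esub> \<sim>\<^bsub>lind\<^esub> x \<curlywedge>\<^bsub>lind\<^esub> (x \<leadsto>\<^bsub>lind\<^esub> y)) \<curlyvee>\<^bsub>lind\<^esub> z = q (subst (inst [a, b, c]) ?P)"
      using abc by (simp add: inst_def zero_q lind_ops fms_def)
    hence "derives M T (subst (inst [a, b, c]) ?P)" using pr lind_one_iff[OF fm'(1)] by simp
    moreover have "({?P}, ?C) \<in> rules M" unfolding rules_min by blast
    ultimately have "derives M T (subst (inst [a, b, c]) ?C)"
      using rg by (intro derives.rl) auto
    hence "q (subst (inst [a, b, c]) ?C) = \<one>\<^bsub>lind\<^esub>" using lind_one_iff[OF fm'(2)] by simp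
    moreover have "q (subst (inst [a, b, c]) ?C) = (circ_op x \<leadsto>\<^bsub>lind\<^esub> circ_op y) \<curlyvee>\<^bsub>lind\<^esub> z"
      using abc by (simp add: inst_def circ_op_q lind_ops fms_def)
    ultimately show ?thesis by simp
  qed
  show ?thesis
    unfolding L_circ_min_chain_def L_circ_chain_def
    using lind_L_chain lind_closed(7) ops one zero coh by auto
qed

end

section \<open>The minimal consistency operator\<close>

lemma mtl_algebra_circ_expand: "mtl_algebra (circ_expand A f) \<longleftrightarrow> mtl_algebra A"
  unfolding mtl_algebra_def mtl_algebra_axioms_def comm_monoid_def comm_monoid_axioms_def
    monoid_def alg_le_def circ_expand_simps
  by (rule refl)

text \<open>The semantic side of soundness. The congruence rule has no counterpart among the conditions on the
  operator: on a chain its premise makes the side element \<open>1\<close> or the two arguments equal.\<close>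
lemma circ_min_L_chain:
  fixes A :: "('a, 'c) alg" (structure)
  assumes "L_circ_min_chain L A f" "core_expansion L"
  shows "L_chain (L_circ_min L) (circ_expand A f)"
proof -
  let ?B = "circ_expand A f"
  have f: "x \<in> carrier A \<Longrightarrow> f x \<in> carrier A"
    and ax: "x \<in> carrier A \<Longrightarrow> x \<curlywedge>\<^bsub>A\<^esub> \<sim>\<^bsub>A\<^esub> x \<curlywedge>\<^bsub>A\<^esub> f x = \<zero>\<^bsub>A\<^esub>"
      "x \<in> carrier A \<Longrightarrow> x \<curlyvee>\<^bsub>A\<^esub> \<sim>\<^bsub>A\<^esub> x \<curlyvee>\<^bsub>A\<^esub> \<sim>\<^bsub>A\<^esub> f x = \<one>\<^bsub>A\<^esub>"
      "f \<one>\<^bsub>A\<^esub> = \<one>\<^bsub>A\<^esub>" "f \<zero>\<^bsub>A\<^esub> = \<one>\<^bsub>A\<^esub>"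
    and coh: "\<lbrakk>x \<in> carrier A; y \<in> carrier A; z \<in> carrier A;
        (\<sim>\<^bsub>A\<^esub> \<sim>\<^bsub>A\<^esub> x \<curlywedge>\<^bsub>A\<^esub> (x \<leadsto>\<^bsub>A\<^esub> y)) \<curlyvee>\<^bsub>A\<^esub> z = \<one>\<^bsub>A\<^esub>\<rbrakk> \<Longrightarrow>
        (f x \<leadsto>\<^bsub>A\<^esub> f y) \<curlyvee>\<^bsub>A\<^esub> z = \<one>\<^bsub>A\<^esub>"
    and L: "L_chain L A" for x y z
    using assms unfolding L_circ_min_chain_def L_circ_chain_def by auto
  interpret mtl_chain A by (rule L_chain_mtl_chain[OF L])
  have alg: "L_algebra L A" using L by (simp add: L_chain_def)
  have ev: "evaluations ?B = evaluations A" by (simp add: evaluations_def)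
  show ?thesis
    unfolding L_chain_def L_algebra_def
  proof (intro conjI ballI allI impI)
    show "mtl_algebra ?B" by (simp add: mtl_algebra_circ_expand mtl_algebra_axioms)
  next
    fix c xs assume c: "c \<in> conns (L_circ_min L)"
      "length xs = arity (L_circ_min L) c \<and> set xs \<subseteq> carrier ?B"
    show "conn ?B c xs \<in> carrier ?B"
    proof (cases c)
      case (Old c')
      thus ?thesis using c alg by (simp add: L_algebra_def)
    next
      case Circ
      thus ?thesis using c f by (cases xs) auto
    qed
  next
    fix e :: "nat \<Rightarrow> 'a" and \<phi> assume e: "e \<in> evaluations ?B" and \<phi>: "\<phi> \<in> axs (L_circ_min L)"
    have x: "e 0 \<in> carrier A" using e by (auto simp: evaluations_def)
    have con: "e 0 \<curlywedge> (\<sim> e 0 \<curlywedge> f (e 0)) = \<zero>" using ax(1)[OF x] x f by (simp add: wedge_assoc)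
    have "e 0 \<curlyvee> (\<sim> e 0 \<curlyvee> \<sim> f (e 0)) = \<one>" using ax(2)[OF x] x f by (simp add: vee_assoc)
    hence min: "eval ?B e (Var 0 \<^bold>\<or> \<^bold>\<not> Var 0 \<^bold>\<or> \<^bold>\<not> \<^bold>\<circle> (Var 0)) = \<one>" using x f by simp
    have old: "eval A e \<psi> = \<one>" if "\<psi> \<in> axs L" for \<psi>
      using that alg e[unfolded ev] by (simp add: L_algebra_def)
    from \<phi> consider \<psi> where "\<psi> \<in> axs L" "\<phi> = old \<psi>"
      | "\<phi> = \<^bold>\<not> (Var 0 \<^bold>\<and> \<^bold>\<not> Var 0 \<^bold>\<and> \<^bold>\<circle> (Var 0))" | "\<phi> = \<^bold>\<circle> \<^bold>\<top>" | "\<phi> = \<^bold>\<circle> \<^bold>\<bottom>"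
      | "\<phi> = Var 0 \<^bold>\<or> \<^bold>\<not> Var 0 \<^bold>\<or> \<^bold>\<not> \<^bold>\<circle> (Var 0)"
      unfolding axs_min by auto
    thus "eval ?B e \<phi> = \<one>\<^bsub>?B\<^esub>"
      by cases (simp_all only: eval_old old con ax
          min[unfolded eval.simps list.map list.sel circ_expand_simps] eval.simps list.map list.sel
          circ_expand_simps zero_resid zero_closed)
  next
    fix e :: "nat \<Rightarrow> 'a" and r assume e: "e \<in> evaluations ?B" and r: "r \<in> rules (L_circ_min L)"
    have x: "e n \<in> carrier A" for n using e by (auto simp: evaluations_def)
    from r consider P \<phi> where "(P, \<phi>) \<in> rules L" "r = (old ` P, old \<phi>)"
    | "r = ({(Var 0 \<^bold>\<leftrightarrow> Var 1) \<^bold>\<or> Var 2}, (\<^bold>\<circle> (Var 0) \<^bold>\<leftrightarrow> \<^bold>\<circle> (Var 1)) \<^bold>\<or> Var 2)"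
    | "r = ({(\<^bold>\<not> \<^bold>\<not> (Var 0) \<^bold>\<and> (Var 0 \<^bold>\<rightarrow> Var 1)) \<^bold>\<or> Var 2}, (\<^bold>\<circle> (Var 0) \<^bold>\<rightarrow> \<^bold>\<circle> (Var 1)) \<^bold>\<or> Var 2)"
    unfolding rules_min by auto
    thus "case r of (P, \<phi>) \<Rightarrow> (\<forall>\<psi>\<in>P. eval ?B e \<psi> = \<one>\<^bsub>?B\<^esub>) \<longrightarrow> eval ?B e \<phi> = \<one>\<^bsub>?B\<^esub>"
    proof cases
      case 1
      have "(\<forall>\<psi>\<in>P. eval A e \<psi> = \<one>) \<longrightarrow> eval A e \<phi> = \<one>"
        using alg 1(1) e[unfolded ev] unfolding L_algebra_def by blast
      thus ?thesis using 1(2) by (simp add: eval_old)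
    next
      case 2
      have "f (e 0) = f (e 1)" if "e 0 \<preceq> e 1" "e 1 \<preceq> e 0"
        using le_antisym[OF that] x by simp
      hence "((e 0 \<leadsto> e 1) \<curlywedge> (e 1 \<leadsto> e 0)) \<curlyvee> e 2 = \<one> \<Longrightarrow>
          ((f (e 0) \<leadsto> f (e 1)) \<curlywedge> (f (e 1) \<leadsto> f (e 0))) \<curlyvee> e 2 = \<one>" using x f by auto
      moreover have "eval ?B e ((Var 0 \<^bold>\<leftrightarrow> Var 1) \<^bold>\<or> Var 2) = ((e 0 \<leadsto> e 1) \<curlywedge> (e 1 \<leadsto> e 0)) \<curlyvee> e 2"
        "eval ?B e ((\<^bold>\<circle> (Var 0) \<^bold>\<leftrightarrow> \<^bold>\<circle> (Var 1)) \<^bold>\<or> Var 2) =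
          ((f (e 0) \<leadsto> f (e 1)) \<curlywedge> (f (e 1) \<leadsto> f (e 0))) \<curlyvee> e 2"
        using x f by simp_all
      ultimately show ?thesis using 2 by (simp only: prod.case circ_expand_simps ball_simps) blast
    next
      case 3
      thus ?thesis using coh[of "e 0" "e 1" "e 2"] x f
        by (simp del: vee_one_iff wedge_one_iff resid_one_iff)
    qed
  qed (use total in \<open>simp add: alg_le_def\<close>)
qed

text \<open>On a chain the join in the defining condition is \<open>1\<close> just if \<open>x = 1\<close>, or \<open>\<not> x = 1\<close>, that is \<open>x = 0\<close>, or
  \<open>\<not> f x = 1\<close>, that is \<open>f x = 0\<close>.\<close>
lemma circ_min_chain_iff_zero_one:
  "L_circ_min_chain L A f \<longleftrightarrow> L_circ_chain L A f \<and> zero_one_operator A f"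
proof (cases "L_circ_chain L A f")
  case True
  hence f: "x \<in> carrier A \<Longrightarrow> f x \<in> carrier A" "f \<one>\<^bsub>A\<^esub> = \<one>\<^bsub>A\<^esub>" "f \<zero>\<^bsub>A\<^esub> = \<one>\<^bsub>A\<^esub>"
    and L: "L_chain L A" for x by (auto simp: L_circ_chain_def)
  interpret mtl_chain A by (rule L_chain_mtl_chain[OF L])
  show ?thesis using True f by (auto simp: L_circ_min_chain_def zero_one_operator_def)
qed (simp add: L_circ_min_chain_def)

text \<open>Coherence is the condition to check: if \<open>\<not> x = 0\<close> and \<open>x \<preceq> y\<close>, then \<open>f x\<close> is \<open>0\<close> unless \<open>x = 1\<close>, and
  then \<open>y = 1\<close>; the case \<open>x = 0\<close> occurs only in the one-element chain.\<close>
lemma zero_one_operator_circ_chain: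
  fixes A :: "('a, 'c) alg" (structure)
  assumes "L_chain L A" "zero_one_operator A f"
  shows "L_circ_chain L A f"
proof -
  interpret mtl_chain A by (rule L_chain_mtl_chain[OF assms(1)])
  have f: "f \<zero> = \<one>" "f \<one> = \<one>" "\<And>x. \<lbrakk>x \<in> carrier A; x \<noteq> \<zero>; x \<noteq> \<one>\<rbrakk> \<Longrightarrow> f x = \<zero>"
    using assms(2) by (auto simp: zero_one_operator_def)
  have cl: "f x \<in> carrier A" if "x \<in> carrier A" for x
    using f that by (cases "x = \<zero> \<or> x = \<one>") auto
  have wedge_zero: "\<zero> \<curlywedge> x = \<zero>" "x \<curlywedge> \<zero> = \<zero>" if "x \<in> carrier A" for x
    using that zero_least[OF that] wedge_comm[OF that] by (auto simp: alg_le_def)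
  have con: "x \<curlywedge> \<sim> x \<curlywedge> f x = \<zero>" if "x \<in> carrier A" for x
  proof -
    consider "x = \<zero>" | "x = \<one>" | "f x = \<zero>" using f(3) \<open>x \<in> carrier A\<close> by blast
    thus ?thesis
      by cases (use that f(1,2) wedge_zero in simp_all)
  qed
  have coh: "f x \<preceq> f y" if "x \<in> carrier A" "y \<in> carrier A" "\<sim> x = \<zero>" "x \<preceq> y" for x y
  proof (cases "x = \<zero> \<or> x = \<one>")
    case True
    thus ?thesis
    proof
      assume "x = \<zero>"
      hence "\<zero> = \<one>" using that by simp
      thus ?thesis using le_if_zero_eq_one cl that by blast
    qed (use f that in auto)
  next
    case False
    thus ?thesis using f that cl zero_least by simp
  qed
  show ?thesis
    unfolding L_circ_chain_def using assms(1) f cl con coh by auto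
qed

text \<open>Every consistency operator is \<open>1\<close> at \<open>0\<close> and \<open>1\<close>, so one that vanishes elsewhere is least. Conversely a
  least one lies below the operator that vanishes elsewhere, which exists on every chain.\<close>
lemma circ_min_chain_iff_least:
  fixes A :: "('a, 'c) alg" (structure)
  shows "L_circ_min_chain L A f \<longleftrightarrow> L_circ_chain L A f \<and> pointwise_least L A f"
proof (cases "L_circ_chain L A f")
  case True
  hence f: "x \<in> carrier A \<Longrightarrow> f x \<in> carrier A" "f \<one>\<^bsub>A\<^esub> = \<one>\<^bsub>A\<^esub>" "f \<zero>\<^bsub>A\<^esub> = \<one>\<^bsub>A\<^esub>"
    and L: "L_chain L A" for x by (auto simp: L_circ_chain_def)
  interpret mtl_chain A by (rule L_chain_mtl_chain[OF L])
  have "pointwise_least L A f" if z: "zero_one_operator A f"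
    unfolding pointwise_least_def
  proof (intro allI impI ballI)
    fix g x assume g: "L_circ_chain L A g" and x: "x \<in> carrier A"
    hence "g x \<in> carrier A" "g \<one> = \<one>" "g \<zero> = \<one>" by (auto simp: L_circ_chain_def)
    thus "f x \<preceq> g x" using z x zero_least by (auto simp: zero_one_operator_def)
  qed
  moreover have "zero_one_operator A f" if least: "pointwise_least L A f"
    unfolding zero_one_operator_def
  proof (intro conjI ballI impI f)
    fix x assume x: "x \<in> carrier A" "x \<noteq> \<zero> \<and> x \<noteq> \<one>"
    let ?g = "\<lambda>x. if x = \<zero> \<or> x = \<one> then \<one> else \<zero>"
    have "L_circ_chain L A ?g"
      by (rule zero_one_operator_circ_chain[OF L]) (simp add: zero_one_operator_def)
    hence "f x \<preceq> ?g x" using least x(1) unfolding pointwise_least_def by blast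
    thus "f x = \<zero>" using x f(1) by simp
  qed
  ultimately show ?thesis using True circ_min_chain_iff_zero_one by metis
qed (simp add: L_circ_min_chain_def)

context semilinear_core_expansion begin

lemma derives_imp_preorder:
  shows "a \<in> fms M \<Longrightarrow> derives M T (a \<^bold>\<rightarrow> a)"
    and "\<lbrakk>derives M T (a \<^bold>\<rightarrow> b); derives M T (b \<^bold>\<rightarrow> c); a \<in> fms M; b \<in> fms M; c \<in> fms M\<rbrakk>
      \<Longrightarrow> derives M T (a \<^bold>\<rightarrow> c)"
proof -
  assume "a \<in> fms M"
  hence "derives M T (subst (inst [a]) (old (Var 0 \<^bold>\<rightarrow> Var 0)))"
    by (intro mtl_consequence[of "{}"]) (auto simp: inst_def fms_def chain_simps)
  thus "derives M T (a \<^bold>\<rightarrow> a)" by (simp add: inst_def)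
next
  assume "derives M T (a \<^bold>\<rightarrow> b)" "derives M T (b \<^bold>\<rightarrow> c)" "a \<in> fms M" "b \<in> fms M" "c \<in> fms M"
  hence "derives M T (subst (inst [a, b, c]) (old (Var 0 \<^bold>\<rightarrow> Var 2)))"
    by (intro mtl_consequence[of "{Var 0 \<^bold>\<rightarrow> Var 1, Var 1 \<^bold>\<rightarrow> Var 2}"])
      (auto simp: inst_def fms_def chain_simps intro: mtl_chain.le_trans)
  thus "derives M T (a \<^bold>\<rightarrow> c)" by (simp add: inst_def)
qed

text \<open>A class is coded by the image under an injection \<open>h\<close> of a representative chosen from it.\<close>
lemma lindenbaum_coding:
  assumes "T \<subseteq> fms M" "\<exists>h :: 'c circ_conn fm \<Rightarrow> 'b. inj_on h (fms M)"
    and "\<And>a b. \<lbrakk>a \<in> fms M; b \<in> fms M; derives M T (a \<^bold>\<or> b)\<rbrakk> \<Longrightarrow> derives M T a \<or> derives M T b"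
  shows "\<exists>q :: 'c circ_conn fm \<Rightarrow> 'b. lindenbaum L ty T q"
proof -
  from assms(2) obtain h :: "'c circ_conn fm \<Rightarrow> 'b" where h: "inj_on h (fms M)" by blast
  define E where "E a b \<longleftrightarrow> b \<in> fms M \<and> derives M T (a \<^bold>\<rightarrow> b) \<and> derives M T (b \<^bold>\<rightarrow> a)" for a b
  define c where "c a = (SOME b. E a b)" for a
  have E_refl: "E a a" if "a \<in> fms M" for a
    using that derives_imp_preorder(1) by (simp add: E_def)
  hence c: "E a (c a)" if "a \<in> fms M" for a
    unfolding c_def using that by (intro someI)
  have eq: "c a = c b" if "a \<in> fms M" "E a b" for a b
  proof -
    have "E a = E b"
      using that derives_imp_preorder(2) by (auto simp: E_def fun_eq_iff)
    thus ?thesis by (simp add: c_def)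
  qed
  have iff: "h (c a) = h (c b) \<longleftrightarrow> derives M T (a \<^bold>\<rightarrow> b) \<and> derives M T (b \<^bold>\<rightarrow> a)"
    if "a \<in> fms M" "b \<in> fms M" for a b
  proof
    assume "h (c a) = h (c b)"
    hence "c a = c b" using h c that by (auto simp: E_def inj_on_def)
    thus "derives M T (a \<^bold>\<rightarrow> b) \<and> derives M T (b \<^bold>\<rightarrow> a)"
      using c[OF that(1)] c[OF that(2)] derives_imp_preorder(2) that
      unfolding E_def by metis
  qed (use eq that in \<open>auto simp: E_def\<close>)
  have "lindenbaum L ty T (\<lambda>a. h (c a))"
    by unfold_locales (use assms iff in auto)
  thus ?thesis by blast
qed

lemma strongly_complete_min:
  assumes "\<exists>h :: 'c circ_conn fm \<Rightarrow> 'b. inj_on h (fms M)"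
  shows "strongly_complete M {circ_expand A f | (A :: ('b, 'c) alg) f. L_circ_min_chain L A f}"
  unfolding strongly_complete_def
proof (intro allI impI iffI)
  fix \<Gamma> \<phi> assume \<Gamma>: "\<Gamma> \<subseteq> fms M" and "\<phi> \<in> fms M" and d: "derives M \<Gamma> \<phi>"
  show "\<forall>B\<in>{circ_expand A f | (A :: ('b, 'c) alg) f. L_circ_min_chain L A f}.
    \<forall>e\<in>evaluations B. (\<forall>\<gamma>\<in>\<Gamma>. eval B e \<gamma> = \<one>\<^bsub>B\<^esub>) \<longrightarrow> eval B e \<phi> = \<one>\<^bsub>B\<^esub>"
    using derives_sound[OF d _ wf_M \<Gamma>] circ_min_L_chain core by blast
next
  fix \<Gamma> \<phi> assume \<Gamma>: "\<Gamma> \<subseteq> fms M" and \<phi>: "\<phi> \<in> fms M"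
    and valid: "\<forall>B\<in>{circ_expand A f | (A :: ('b, 'c) alg) f. L_circ_min_chain L A f}.
      \<forall>e\<in>evaluations B. (\<forall>\<gamma>\<in>\<Gamma>. eval B e \<gamma> = \<one>\<^bsub>B\<^esub>) \<longrightarrow> eval B e \<phi> = \<one>\<^bsub>B\<^esub>"
  show "derives M \<Gamma> \<phi>"
  proof (rule ccontr)
    assume "\<not> derives M \<Gamma> \<phi>"
    with \<Gamma> obtain T where T: "\<Gamma> \<subseteq> T" "T \<subseteq> fms M" "\<not> derives M T \<phi>"
      and pr: "\<And>a b. \<lbrakk>a \<in> fms M; b \<in> fms M; derives M T (a \<^bold>\<or> b)\<rbrakk> \<Longrightarrow> derives M T a \<or> derives M T b"
      using prime_extension by blast
    obtain q :: "'c circ_conn fm \<Rightarrow> 'b" where "lindenbaum L ty T q"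
      using lindenbaum_coding[OF T(2) assms pr] by blast
    then interpret lindenbaum L ty T q .
    let ?B = "circ_expand lind circ_op" and ?e = "\<lambda>n. q (Var n)"
    have var: "subst Var a = a" for a :: "'c circ_conn fm" by (induction a) (auto simp: map_idI)
    have e: "eval ?B ?e a = q a" if "a \<in> fms M" for a
      using eval_lind[of Var a] that by (simp add: var fms_def image_subset_iff)
    have one: "eval ?B ?e a = \<one>\<^bsub>?B\<^esub> \<longleftrightarrow> derives M T a" if "a \<in> fms M" for a
      using that e lind_one_iff by simp
    have "?e \<in> evaluations ?B" by (auto simp: evaluations_def lind_def fms_def)
    moreover have "\<forall>\<gamma>\<in>\<Gamma>. eval ?B ?e \<gamma> = \<one>\<^bsub>?B\<^esub>"
      using one \<Gamma> T(1) derives.hyp by blast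
    ultimately have "eval ?B ?e \<phi> = \<one>\<^bsub>?B\<^esub>" using valid lind_circ_min_chain by blast
    thus False using one \<phi> T(3) by blast
  qed
qed

end

theorem proposition4p17:
  fixes L :: "'c calculus"
  assumes "core_expansion L"
    and "semilinear TYPE('a) L"
    and "\<not> SMTL_logic L"
    and large: "\<exists>h :: 'c circ_conn fm \<Rightarrow> 'b. inj_on h (fms (L_circ_min L))"
  shows "strongly_complete (L_circ_min L)
           {circ_expand A f | (A :: ('b, 'c) alg) f. L_circ_min_chain L A f} \<and>
         (\<forall>(A :: ('b, 'c) alg) f.
           (L_circ_min_chain L A f \<longleftrightarrow> L_circ_chain L A f \<and> zero_one_operator A f) \<and>
           (L_circ_min_chain L A f \<longleftrightarrow> L_circ_chain L A f \<and> pointwise_least L A f))"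
proof -
  interpret semilinear_core_expansion L "TYPE('a)"
    using assms(1,2) by unfold_locales
  show ?thesis
    using strongly_complete_min[OF large] circ_min_chain_iff_zero_one circ_min_chain_iff_least by blast
qed

end
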